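(* For $n\ge 2$, the group $TVP_n$ is generated by the elements $\lambda_{kl}$ ($1\le k\ne l\le n$) and $\gamma_j$ ($1\le j\le n$), and a complete set of defining relations in these generators is: $\lambda_{ij}\lambda_{kl}=\lambda_{kl}\lambda_{ij}$ for pairwise distinct $i,j,k,l$; $\lambda_{ki}\lambda_{kj}\lambda_{ij}=\lambda_{ij}\lambda_{kj}\lambda_{ki}$ for pairwise distinct $i,j,k$; $\gamma_i^2=1$; $\gamma_i\gamma_j=\gamma_j\gamma_i$ for $i\neq j$; $\lambda_{ij}\gamma_k=\gamma_k\lambda_{ij}$ for pairwise distinct $i,j,k$; $\lambda_{ij}=\gamma_i\gamma_j\lambda_{ji}\gamma_j\gamma_i$ for $i\ne j$.
   Context: For $n\ge 2$, the twisted virtual braid group $TVB_n$ is the group with generators $\sigma_1,\dots,\sigma_{n-1}$, $\rho_1,\dots,\rho_{n-1}$, $\gamma_1,\dots,\gamma_n$ and defining relations: $\sigma_i\sigma_{i+1}\sigma_i=\sigma_{i+1}\sigma_i\sigma_{i+1}$ ($1\le i\le n-2$); $\sigma_i\sigma_j=\sigma_j\sigma_i$ ($|i-j|\ge 2$); $\rho_i^2=1$; $\rho_i\rho_j=\rho_j\rho_i$ ($|i-j|\ge2$); $\rho_i\rho_{i+1}\rho_i=\rho_{i+1}\rho_i\rho_{i+1}$ ($1\le i\le n-2$); $\sigma_i\rho_j=\rho_j\sigma_i$ ($|i-j|\ge 2$); $\rho_i\rho_{i+1}\sigma_i=\sigma_{i+1}\rho_i\rho_{i+1}$ ($1\le i\le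 n-2$); $\gamma_i^2=1$ and $\gamma_i\gamma_j=\gamma_j\gamma_i$ (all $i,j$); $\gamma_j\rho_i=\rho_i\gamma_j$ and $\gamma_j\sigma_i=\sigma_i\gamma_j$ for $j\notin\{i,i+1\}$; $\rho_i\gamma_i=\gamma_{i+1}\rho_i$ ($1\le i\le n-1$); $\rho_i\sigma_i\rho_i=\gamma_{i+1}\gamma_i\sigma_i\gamma_i\gamma_{i+1}$ ($1\le i\le n-1$). $\varphi_P:TVB_n\to S_n$ is the homomorphism with $\sigma_i\mapsto(i,i+1)$, $\rho_i\mapsto(i,i+1)$, $\gamma_j\mapsto e$, and the twisted virtual pure braid group is $TVP_n=\ker\varphi_P$. In $TVB_n$ define $\lambda_{i,i+1}=\rho_i\sigma_i^{-1}$, $\lambda_{i+1,i}=\rho_i\lambda_{i,i+1}\rho_i$ ($1\le i\le n-1$), and for $1\le i<j-1\le n-1$: $\lambda_{ij}=\rho_{j-1}\rho_{j-2}\cdots\rho_{i+1}\lambda_{i,i+1}\rho_{i+1}\cdots\rho_{j-2}\rho_{j-1}$, $\lambda_{ji}=\rho_{j-1}\rho_{j-2}\cdots\rho_{i+1}\lambda_{i+1,i}\rho_{i+1}\cdots\rho_{j-2}\rho_{j-1}$. *)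

theory Defs
  imports "HOL-Algebra.Group" "HOL-Combinatorics.Transposition"
begin

text \<open>A letter is a generator together with a flag; (x, False) is x and (x, True) is x^-1.\<close>
type_synonym 'a word = "('a \<times> bool) list"

definition pw :: "'a list \<Rightarrow> 'a word" where
  "pw xs = map (\<lambda>x. (x, False)) xs"

definition words :: "'a set \<Rightarrow> 'a word set" where
  "words X = lists (X \<times> UNIV)"

inductive pres_eq :: "'a set \<Rightarrow> ('a word \<times> 'a word) set \<Rightarrow> 'a word \<Rightarrow> 'a word \<Rightarrow> bool"
  for X R where
  refl: "w \<in> words X \<Longrightarrow> pres_eq X R w w"
| sym: "pres_eq X R u v \<Longrightarrow> pres_eq X R v u"
| trans: "pres_eq X R u v \<Longrightarrow> pres_eq X R v w \<Longrightarrow> pres_eq X R u w"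
| cancel: "u \<in> words X \<Longrightarrow> v \<in> words X \<Longrightarrow> x \<in> X \<Longrightarrow>
            pres_eq X R (u @ [(x, b), (x, \<not> b)] @ v) (u @ v)"
| rel: "(l, r) \<in> R \<Longrightarrow> l \<in> words X \<Longrightarrow> r \<in> words X \<Longrightarrow> u \<in> words X \<Longrightarrow> v \<in> words X \<Longrightarrow>
            pres_eq X R (u @ l @ v) (u @ r @ v)"

definition pres_rel :: "'a set \<Rightarrow> ('a word \<times> 'a word) set \<Rightarrow> ('a word \<times> 'a word) set" where
  "pres_rel X R = {(u, v). pres_eq X R u v}"

definition pres_group :: "'a set \<Rightarrow> ('a word \<times> 'a word) set \<Rightarrow> 'a word set monoid" where
  "pres_group X R =
     \<lparr> carrier = words X // pres_rel X R,
       mult = (\<lambda>A B. pres_rel X R `` {u @ v | u v. u \<in> A \<and> v \<in> B}),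
       one = pres_rel X R `` {[]} \<rparr>"

definition pres_class :: "'a set \<Rightarrow> ('a word \<times> 'a word) set \<Rightarrow> 'a word \<Rightarrow> 'a word set" where
  "pres_class X R w = pres_rel X R `` {w}"

datatype tvb_gen = Sg nat | Rh nat | Gm nat

definition tvb_gens :: "nat \<Rightarrow> tvb_gen set" where
  "tvb_gens n = {Sg i | i. 1 \<le> i \<and> i \<le> n - 1} \<union> {Rh i | i. 1 \<le> i \<and> i \<le> n - 1}
              \<union> {Gm j | j. 1 \<le> j \<and> j \<le> n}"

definition tvb_rels :: "nat \<Rightarrow> (tvb_gen word \<times> tvb_gen word) set" where
  "tvb_rels n =
     {(pw [Sg i, Sg (i+1), Sg i], pw [Sg (i+1), Sg i, Sg (i+1)]) | i. 1 \<le> i \<and> i \<le> n - 2}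
   \<union> {(pw [Sg i, Sg j], pw [Sg j, Sg i]) | i j. 1 \<le> i \<and> i \<le> n - 1 \<and> 1 \<le> j \<and> j \<le> n - 1 \<and> (i + 2 \<le> j \<or> j + 2 \<le> i)}
   \<union> {(pw [Rh i, Rh i], []) | i. 1 \<le> i \<and> i \<le> n - 1}
   \<union> {(pw [Rh i, Rh j], pw [Rh j, Rh i]) | i j. 1 \<le> i \<and> i \<le> n - 1 \<and> 1 \<le> j \<and> j \<le> n - 1 \<and> (i + 2 \<le> j \<or> j + 2 \<le> i)}
   \<union> {(pw [Rh i, Rh (i+1), Rh i], pw [Rh (i+1), Rh i, Rh (i+1)]) | i. 1 \<le> i \<and> i \<le> n - 2}
   \<union> {(pw [Sg i, Rh j], pw [Rh j, Sg i]) | i j. 1 \<le> i \<and> i \<le> n - 1 \<and> 1 \<le> j \<and> j \<le> n - 1 \<and> (i + 2 \<le> j \<or> j + 2 \<le> i)}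
   \<union> {(pw [Rh i, Rh (i+1), Sg i], pw [Sg (i+1), Rh i, Rh (i+1)]) | i. 1 \<le> i \<and> i \<le> n - 2}
   \<union> {(pw [Gm i, Gm i], []) | i. 1 \<le> i \<and> i \<le> n}
   \<union> {(pw [Gm i, Gm j], pw [Gm j, Gm i]) | i j. 1 \<le> i \<and> i \<le> n \<and> 1 \<le> j \<and> j \<le> n}
   \<union> {(pw [Gm j, Rh i], pw [Rh i, Gm j]) | i j. 1 \<le> i \<and> i \<le> n - 1 \<and> 1 \<le> j \<and> j \<le> n \<and> j \<noteq> i \<and> j \<noteq> i + 1}
   \<union> {(pw [Gm j, Sg i], pw [Sg i, Gm j]) | i j. 1 \<le> i \<and> i \<le> n - 1 \<and> 1 \<le> j \<and> j \<le> n \<and> j \<noteq> i \<and> j \<noteq> i + 1}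
   \<union> {(pw [Rh i, Gm i], pw [Gm (i+1), Rh i]) | i. 1 \<le> i \<and> i \<le> n - 1}
   \<union> {(pw [Rh i, Sg i, Rh i], pw [Gm (i+1), Gm i, Sg i, Gm i, Gm (i+1)]) | i. 1 \<le> i \<and> i \<le> n - 1}"

definition TVB :: "nat \<Rightarrow> tvb_gen word set monoid" where
  "TVB n = pres_group (tvb_gens n) (tvb_rels n)"

definition tvb_class :: "nat \<Rightarrow> tvb_gen word \<Rightarrow> tvb_gen word set" where
  "tvb_class n w = pres_class (tvb_gens n) (tvb_rels n) w"

text \<open>The permutation (of nat, supported in {1..n}) of a word: sigma_i, rho_i go to (i,i+1), gamma_j to e.\<close>
fun letter_perm :: "tvb_gen \<times> bool \<Rightarrow> nat \<Rightarrow> nat" where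
  "letter_perm (Sg i, _) = transpose i (i + 1)"
| "letter_perm (Rh i, _) = transpose i (i + 1)"
| "letter_perm (Gm j, _) = id"

definition word_perm :: "tvb_gen word \<Rightarrow> nat \<Rightarrow> nat" where
  "word_perm w = foldr (\<lambda>a f. letter_perm a \<circ> f) w id"

definition phiP :: "tvb_gen word set \<Rightarrow> nat \<Rightarrow> nat" where
  "phiP A = word_perm (SOME w. w \<in> A)"

definition TVP :: "nat \<Rightarrow> tvb_gen word set set" where
  "TVP n = {A \<in> carrier (TVB n). phiP A = id}"

definition rho_chain :: "nat \<Rightarrow> nat \<Rightarrow> tvb_gen word" where
  "rho_chain i j = pw (map Rh (rev [i+1..<j]))"

definition lam_word :: "nat \<Rightarrow> nat \<Rightarrow> tvb_gen word" where
  "lam_word k l =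
     (if k < l then rho_chain k l @ [(Rh k, False), (Sg k, True)] @ rev (rho_chain k l)
      else rho_chain l k @ [(Rh l, False), (Rh l, False), (Sg l, True), (Rh l, False)] @ rev (rho_chain l k))"

datatype tvp_gen = L nat nat | G nat

definition tvp_gens :: "nat \<Rightarrow> tvp_gen set" where
  "tvp_gens n = {L k l | k l. 1 \<le> k \<and> k \<le> n \<and> 1 \<le> l \<and> l \<le> n \<and> k \<noteq> l} \<union> {G j | j. 1 \<le> j \<and> j \<le> n}"

definition tvp_rels :: "nat \<Rightarrow> (tvp_gen word \<times> tvp_gen word) set" where
  "tvp_rels n =
     {(pw [L i j, L k l], pw [L k l, L i j]) | i j k l.
        distinct [i, j, k, l] \<and> {i, j, k, l} \<subseteq> {1..n}}
   \<union> {(pw [L k i, L k j, L i j], pw [L i j, L k j, L k i]) | i j k.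
        distinct [i, j, k] \<and> {i, j, k} \<subseteq> {1..n}}
   \<union> {(pw [G i, G i], []) | i. 1 \<le> i \<and> i \<le> n}
   \<union> {(pw [G i, G j], pw [G j, G i]) | i j. i \<noteq> j \<and> {i, j} \<subseteq> {1..n}}
   \<union> {(pw [L i j, G k], pw [G k, L i j]) | i j k. distinct [i, j, k] \<and> {i, j, k} \<subseteq> {1..n}}
   \<union> {(pw [L i j], pw [G i, G j, L j i, G j, G i]) | i j. i \<noteq> j \<and> {i, j} \<subseteq> {1..n}}"

definition TVP_pres :: "nat \<Rightarrow> tvp_gen word set monoid" where
  "TVP_pres n = pres_group (tvp_gens n) (tvp_rels n)"

definition tvp_class :: "nat \<Rightarrow> tvp_gen word \<Rightarrow> tvp_gen word set" where
  "tvp_class n w = pres_class (tvp_gens n) (tvp_rels n) w"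

end

theory Submission
  imports Defs "HOL-Combinatorics.Permutations"
begin

text \<open>
  Let \<open>P\<close> be the group presented by the relations in the \<open>\<lambda>\<close> and \<open>\<gamma>\<close>. The symmetric group acts on \<open>P\<close>
  by permuting indices, and \<open>TVB\<^sub>n\<close> maps to \<open>P \<rtimes> S\<^sub>n\<close>. Conversely, conjugation by \<open>\<rho>\<^sub>m\<close> permutes the
  indices of the elements \<open>\<lambda>\<^bsub>kl\<^esub>\<close> and \<open>\<gamma>\<^sub>j\<close> of \<open>TVB\<^sub>n\<close>, so each relation of \<open>P\<close> need only be
  checked there for the smallest indices, and \<open>P\<close> maps to \<open>TVB\<^sub>n\<close>. The composite \<open>P \<rightarrow> TVB\<^sub>n \<rightarrow> P \<rtimes> S\<^sub>n\<close>
  is the inclusion, whence injectivity. Every element of \<open>TVB\<^sub>n\<close> is an element of the image of \<open>P\<close>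
  times a word in the \<open>\<rho>\<^sub>i\<close>. If its permutation is trivial, then so is that of the \<open>\<rho>\<close>-word, which is
  therefore \<open>1\<close> because the Coxeter relations present \<open>S\<^sub>n\<close>; whence surjectivity onto \<open>TVP\<^sub>n\<close>.
\<close>

section \<open>Presentations\<close>

lemma words_simps [simp]:
  "[] \<in> words X"
  "a # w \<in> words X \<longleftrightarrow> fst a \<in> X \<and> w \<in> words X"
  "u @ v \<in> words X \<longleftrightarrow> u \<in> words X \<and> v \<in> words X"
  "rev w \<in> words X \<longleftrightarrow> w \<in> words X"
  by (auto simp: words_def lists_eq_set mem_Times_iff)

lemma words_conv_set: "w \<in> words X \<longleftrightarrow> fst ` set w \<subseteq> X"
  by (induction w) auto

lemma pres_eq_words:
  assumes "pres_eq X R u v"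
  shows "u \<in> words X" "v \<in> words X"
  using assms by (induction) auto

lemma pres_eq_context:
  assumes "pres_eq X R u v" "a \<in> words X" "b \<in> words X"
  shows "pres_eq X R (a @ u @ b) (a @ v @ b)"
  using assms(1)
proof induction
  case (refl w)
  then show ?case using assms by (intro pres_eq.refl) auto
next
  case (sym u v)
  then show ?case by (blast intro: pres_eq.sym)
next
  case (trans u v w)
  then show ?case by (blast intro: pres_eq.trans)
next
  case (cancel u v x c)
  then show ?case using assms pres_eq.cancel[of "a @ u" X "v @ b" x R c] by simp
next
  case (rel l r u v)
  then show ?case using assms pres_eq.rel[of l r R X "a @ u" "v @ b"] by simp
qed

lemma pres_eq_append:
  assumes "pres_eq X R u u'" "pres_eq X R v v'"
  shows "pres_eq X R (u @ v) (u' @ v')"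
  using pres_eq_context[OF assms(1), of "[]" v] pres_eq_context[OF assms(2), of u' "[]"]
    pres_eq_words[OF assms(1)] pres_eq_words[OF assms(2)]
  by (auto intro: pres_eq.trans)

lemma mem_pres_class_iff: "v \<in> pres_class X R u \<longleftrightarrow> pres_eq X R u v"
  by (simp add: pres_class_def pres_rel_def)

text \<open>The hypothesis makes \<open>u\<close> a member of its own class; a list outside
  \<open>words X\<close> has the empty class.\<close>

lemma pres_class_eq_iff:
  assumes "u \<in> words X"
  shows "pres_class X R u = pres_class X R v \<longleftrightarrow> pres_eq X R u v"
proof
  assume "pres_class X R u = pres_class X R v"
  then have "u \<in> pres_class X R v"
    using assms pres_eq.refl by (metis mem_pres_class_iff)
  then show "pres_eq X R u v" by (simp add: mem_pres_class_iff pres_eq.sym)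
next
  assume "pres_eq X R u v"
  then show "pres_class X R u = pres_class X R v"
    unfolding set_eq_iff mem_pres_class_iff by (blast intro: pres_eq.sym pres_eq.trans)
qed

lemma words_quotient_pres_rel: "words X // pres_rel X R = pres_class X R ` words X"
  by (auto simp: quotient_def pres_class_def)

lemma carrier_pres_group: "carrier (pres_group X R) = pres_class X R ` words X"
  by (simp add: pres_group_def words_quotient_pres_rel)

lemma pres_eq_SOME:
  assumes "w \<in> words X"
  shows "pres_eq X R w (SOME v. v \<in> pres_class X R w)"
  using someI[of "\<lambda>v. v \<in> pres_class X R w" w] assms
  by (simp add: mem_pres_class_iff pres_eq.refl)

text \<open>All products of representatives are equivalent by \<open>pres_eq_append\<close>, so
  saturating them in \<open>pres_group\<close> gives a single class.\<close>

lemma mult_pres_class: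
  assumes "u \<in> words X" "v \<in> words X"
  shows "pres_class X R u \<otimes>\<^bsub>pres_group X R\<^esub> pres_class X R v = pres_class X R (u @ v)"
proof -
  have "pres_class X R u \<otimes>\<^bsub>pres_group X R\<^esub> pres_class X R v
      = {w. \<exists>u' v'. pres_eq X R u u' \<and> pres_eq X R v v' \<and> pres_eq X R (u' @ v') w}"
    by (auto simp: pres_group_def mem_pres_class_iff pres_rel_def)
  also have "\<dots> = pres_class X R (u @ v)"
    unfolding set_eq_iff mem_Collect_eq mem_pres_class_iff
    by (metis assms pres_eq.refl pres_eq.trans pres_eq_append)
  finally show ?thesis .
qed

text \<open>
  Identities in a presented group are checked in an arbitrary action of the presentation: there
  associativity holds definitionally, so that the defining relations become ordinary rewrite rules.
  The left regular action (\<open>pact\<close> below) is faithful, which brings the identities back to words.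
\<close>

locale pres_action =
  fixes X :: "'x set" and R :: "('x word \<times> 'x word) set" and act :: "'x \<times> bool \<Rightarrow> 'a \<Rightarrow> 'a"
  assumes act_cancel: "x \<in> X \<Longrightarrow> act (x, b) (act (x, \<not> b) y) = y"
    and act_rel: "(l, r) \<in> R \<Longrightarrow> l \<in> words X \<Longrightarrow> r \<in> words X \<Longrightarrow> foldr act l y = foldr act r y"
begin

lemma act_cancel_simps [simp]:
  "x \<in> X \<Longrightarrow> act (x, True) (act (x, False) y) = y"
  "x \<in> X \<Longrightarrow> act (x, False) (act (x, True) y) = y"
  using act_cancel[of x True] act_cancel[of x False] by auto

lemma act_inj: "x \<in> X \<Longrightarrow> act (x, b) y = act (x, b) z \<longleftrightarrow> y = z"
  using act_cancel[of x "\<not> b"] by (metis (full_types))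

text \<open>Lets the flag of an involutive letter be ignored, as for \<rho> and \<gamma>.\<close>

lemma act_involution_inverse:
  assumes "x \<in> X" "\<And>y. act (x, False) (act (x, False) y) = y"
  shows "act (x, b) y = act (x, False) y"
  using assms by (cases b) (metis act_cancel_simps(1), simp)

end

text \<open>Off the set of classes every letter acts as the identity, so that the laws of
  \<open>pres_action\<close> hold for all arguments of the type, with no carrier condition.\<close>

definition pact :: "'x set \<Rightarrow> ('x word \<times> 'x word) set \<Rightarrow> 'x \<times> bool \<Rightarrow> 'x word set \<Rightarrow> 'x word set"
  where "pact X R a A =
    (if fst a \<in> X \<and> A \<in> pres_class X R ` words X then pres_class X R (a # (SOME w. w \<in> A)) else A)"

lemma pact_class:
  assumes "fst a \<in> X" "w \<in> words X"
  shows "pact X R a (pres_class X R w) = pres_class X R (a # w)"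
proof -
  have "pres_eq X R (a # w) (a # (SOME v. v \<in> pres_class X R w))"
    using pres_eq_append[OF pres_eq.refl[of "[a]"] pres_eq_SOME[OF assms(2)]] assms by simp
  then show ?thesis
    using assms pres_class_eq_iff[of "a # w" X R] by (auto simp: pact_def)
qed

lemma foldr_pact_class:
  assumes "u \<in> words X" "w \<in> words X"
  shows "foldr (pact X R) u (pres_class X R w) = pres_class X R (u @ w)"
  using assms by (induction u) (auto simp: pact_class)

lemma foldr_pact_outside:
  "A \<notin> pres_class X R ` words X \<Longrightarrow> foldr (pact X R) u A = A"
  by (induction u) (auto simp: pact_def)

text \<open>Faithfulness: evaluation at the class of \<open>[]\<close> recovers the class of the
  word. The other direction is the congruence property of \<open>pres_eq\<close>.\<close>

lemma foldr_pact_eq_iff: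
  assumes "u \<in> words X" "v \<in> words X"
  shows "foldr (pact X R) u = foldr (pact X R) v \<longleftrightarrow> pres_eq X R u v"
proof
  assume "foldr (pact X R) u = foldr (pact X R) v"
  then have "pres_class X R (u @ []) = pres_class X R (v @ [])"
    using foldr_pact_class[of _ X "[]" R] assms by (metis words_simps(1))
  then show "pres_eq X R u v" using assms by (simp add: pres_class_eq_iff)
next
  assume uv: "pres_eq X R u v"
  show "foldr (pact X R) u = foldr (pact X R) v"
  proof
    fix A
    show "foldr (pact X R) u A = foldr (pact X R) v A"
    proof (cases "A \<in> pres_class X R ` words X")
      case True
      then obtain w where "w \<in> words X" "A = pres_class X R w" by blast
      then show ?thesis
        using assms uv pres_eq_append[OF uv pres_eq.refl[of w]]
        by (simp add: foldr_pact_class pres_class_eq_iff)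
    qed (simp add: foldr_pact_outside)
  qed
qed

lemma pres_action_pact: "pres_action X R (pact X R)"
proof
  fix x b and y :: "'a word set"
  assume "x \<in> X"
  then have "pres_eq X R [(x, b), (x, \<not> b)] []"
    using pres_eq.cancel[of "[]" X "[]" x R b] by simp
  then have "foldr (pact X R) [(x, b), (x, \<not> b)] = foldr (pact X R) []"
    using foldr_pact_eq_iff \<open>x \<in> X\<close> by (metis pres_eq_words)
  then show "pact X R (x, b) (pact X R (x, \<not> b) y) = y"
    by (auto dest: fun_cong[of _ _ y])
next
  fix l r and y :: "'a word set"
  assume "(l, r) \<in> R" "l \<in> words X" "r \<in> words X"
  then show "foldr (pact X R) l y = foldr (pact X R) r y"
    using pres_eq.rel[of l r R X "[]" "[]"] by (simp add: foldr_pact_eq_iff[symmetric])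
qed

text \<open>The universal property of a presentation, on the level of words: a homomorphism of word
  monoids descends to the groups once it respects cancelling pairs and relators.\<close>

lemma pres_eq_substitution:
  fixes f :: "'x word \<Rightarrow> 'y word"
  assumes "pres_eq X R u v"
    and hom: "\<And>u v. f (u @ v) = f u @ f v"
    and words: "\<And>w. w \<in> words X \<Longrightarrow> f w \<in> words Y"
    and cancel: "\<And>x b. x \<in> X \<Longrightarrow> pres_eq Y S (f [(x, b), (x, \<not> b)]) []"
    and rel: "\<And>l r. (l, r) \<in> R \<Longrightarrow> l \<in> words X \<Longrightarrow> r \<in> words X \<Longrightarrow> pres_eq Y S (f l) (f r)"
  shows "pres_eq Y S (f u) (f v)"
  using assms(1)
proof induction
  case (refl w)
  then show ?case by (intro pres_eq.refl words)
next
  case (sym u v)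
  then show ?case by (blast intro: pres_eq.sym)
next
  case (trans u v w)
  then show ?case by (blast intro: pres_eq.trans)
next
  case (cancel u v x c)
  then show ?case
    using pres_eq_context[OF assms(4)[of x c], of "f u" "f v"] words unfolding hom by simp
next
  case (rel l r u v)
  then show ?case
    using pres_eq_context[OF assms(5)[of l r], of "f u" "f v"] words unfolding hom by simp
qed

section \<open>Formal inverses of words\<close>

definition winv :: "'x word \<Rightarrow> 'x word"
  where "winv w = rev (map (apsnd Not) w)"

lemma winv_words [simp]: "winv w \<in> words X \<longleftrightarrow> w \<in> words X"
  by (induction w) (auto simp: winv_def)

lemma winv_winv [simp]: "winv (winv w) = w"
  by (induction w) (auto simp: winv_def)

context pres_action
begin

lemma foldr_act_winv: "w \<in> words X \<Longrightarrow> foldr act (winv w) (foldr act w y) = y"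
proof (induction w)
  case (Cons a w)
  then show ?case using act_cancel[of "fst a" "\<not> snd a"] by (cases a) (auto simp: winv_def)
qed (simp add: winv_def)

lemma foldr_act_winv': "w \<in> words X \<Longrightarrow> foldr act w (foldr act (winv w) y) = y"
  using foldr_act_winv[of "winv w"] by simp

text \<open>Used to invert the relations of P, because \<open>coc\<close> sends the positive letter
  of \<open>Sg i\<close> to an inverse letter.\<close>

lemma foldr_act_winv_cong:
  assumes "u \<in> words X" "v \<in> words X" "\<And>y. foldr act u y = foldr act v y"
  shows "foldr act (winv u) y = foldr act (winv v) y"
  using assms by (metis foldr_act_winv foldr_act_winv')

end

section \<open>The permutation of a word\<close>

lemma tvb_gens_simps [simp]:
  "Sg i \<in> tvb_gens n \<longleftrightarrow> i \<in> {1..<n}"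
  "Rh i \<in> tvb_gens n \<longleftrightarrow> i \<in> {1..<n}"
  "Gm i \<in> tvb_gens n \<longleftrightarrow> i \<in> {1..n}"
  by (auto simp: tvb_gens_def)

lemma tvp_gens_simps [simp]:
  "L k l \<in> tvp_gens n \<longleftrightarrow> k \<in> {1..n} \<and> l \<in> {1..n} \<and> k \<noteq> l"
  "G i \<in> tvp_gens n \<longleftrightarrow> i \<in> {1..n}"
  by (auto simp: tvp_gens_def)

lemma word_perm_Nil [simp]: "word_perm [] = id"
  by (simp add: word_perm_def)

lemma word_perm_Cons [simp]: "word_perm (a # w) = letter_perm a \<circ> word_perm w"
  by (simp add: word_perm_def)

lemma word_perm_append [simp]: "word_perm (u @ v) = word_perm u \<circ> word_perm v"
  by (induction u) (auto simp: o_assoc)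

lemma letter_perm_permutes:
  assumes "fst a \<in> tvb_gens n"
  shows "letter_perm a permutes {1..n}"
proof (cases a rule: letter_perm.cases)
  case (3 j b)
  then show ?thesis by (simp add: permutes_id[unfolded id_def] id_def)
qed (use assms in \<open>auto intro!: permutes_swap_id\<close>)

lemma word_perm_permutes: "w \<in> words (tvb_gens n) \<Longrightarrow> word_perm w permutes {1..n}"
proof (induction w)
  case (Cons a w)
  then show ?case unfolding word_perm_Cons by (intro permutes_compose letter_perm_permutes) auto
qed (simp add: permutes_id)

lemma letter_perm_involution: "letter_perm (x, b) \<circ> letter_perm (x, c) = id"
  by (cases x) auto

lemma transpose_braid:
  "transpose i (Suc i) (transpose (Suc i) (Suc (Suc i)) (transpose i (Suc i) x)) =
   transpose (Suc i) (Suc (Suc i)) (transpose i (Suc i) (transpose (Suc i) (Suc (Suc i)) x))"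
  by (auto simp: transpose_def)

lemma transpose_far:
  "i + 2 \<le> j \<or> j + 2 \<le> i \<Longrightarrow>
   transpose i (Suc i) (transpose j (Suc j) x) = transpose j (Suc j) (transpose i (Suc i) x)"
  by (auto simp: transpose_def)

lemma word_perm_rel: "(l, r) \<in> tvb_rels n \<Longrightarrow> word_perm l = word_perm r"
  unfolding tvb_rels_def pw_def
  by (auto simp: fun_eq_iff transpose_braid transpose_far)

text \<open>This makes the homomorphism to the symmetric group well defined on classes.\<close>

lemma word_perm_pres_eq:
  assumes "pres_eq (tvb_gens n) (tvb_rels n) u v"
  shows "word_perm u = word_perm v"
  using assms
proof induction
  case (cancel u v x b)
  have "letter_perm (x, b) \<circ> (letter_perm (x, \<not> b) \<circ> word_perm v) = word_perm v"
    by (simp add: o_assoc letter_perm_involution)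
  then show ?case by simp
qed (auto dest: word_perm_rel)

section \<open>The cocycle\<close>

fun relabel :: "(nat \<Rightarrow> nat) \<Rightarrow> tvp_gen \<Rightarrow> tvp_gen" where
  "relabel p (L k l) = L (p k) (p l)"
| "relabel p (G j) = G (p j)"

abbreviation relabel_word :: "(nat \<Rightarrow> nat) \<Rightarrow> tvp_gen word \<Rightarrow> tvp_gen word" where
  "relabel_word p \<equiv> map (apfst (relabel p))"

lemma relabel_id: "relabel id x = x"
  by (cases x) auto

lemma relabel_comp: "relabel p (relabel q x) = relabel (p \<circ> q) x"
  by (cases x) auto

lemma relabel_word_id: "relabel_word id w = w"
  by (rule map_idI) (metis apfst_conv prod.collapse relabel_id)

lemma relabel_word_comp: "relabel_word p (relabel_word q w) = relabel_word (p \<circ> q) w"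
  unfolding map_map by (rule map_cong[OF HOL.refl]) (metis apfst_conv comp_apply prod.collapse relabel_comp)

lemma relabel_gens:
  assumes "p permutes {1..n}" "x \<in> tvp_gens n"
  shows "relabel p x \<in> tvp_gens n"
  using assms permutes_in_image[OF assms(1)] permutes_inj[OF assms(1)]
  by (cases x) (auto simp: inj_eq simp del: atLeastAtMost_iff)

lemma relabel_word_words:
  assumes "p permutes {1..n}" "w \<in> words (tvp_gens n)"
  shows "relabel_word p w \<in> words (tvp_gens n)"
  using assms(2) by (induction w) (auto simp: relabel_gens[OF assms(1)])

lemma tvp_relsI:
  "distinct [i, j, k, l] \<Longrightarrow> {i, j, k, l} \<subseteq> {1..n} \<Longrightarrow>
     (pw [L i j, L k l], pw [L k l, L i j]) \<in> tvp_rels n"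
  "distinct [i, j, k] \<Longrightarrow> {i, j, k} \<subseteq> {1..n} \<Longrightarrow>
     (pw [L k i, L k j, L i j], pw [L i j, L k j, L k i]) \<in> tvp_rels n"
  "{i} \<subseteq> {1..n} \<Longrightarrow> (pw [G i, G i], []) \<in> tvp_rels n"
  "i \<noteq> j \<Longrightarrow> {i, j} \<subseteq> {1..n} \<Longrightarrow> (pw [G i, G j], pw [G j, G i]) \<in> tvp_rels n"
  "distinct [i, j, k] \<Longrightarrow> {i, j, k} \<subseteq> {1..n} \<Longrightarrow> (pw [L i j, G k], pw [G k, L i j]) \<in> tvp_rels n"
  "i \<noteq> j \<Longrightarrow> {i, j} \<subseteq> {1..n} \<Longrightarrow> (pw [L i j], pw [G i, G j, L j i, G j, G i]) \<in> tvp_rels n"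
  unfolding tvp_rels_def by (blast, blast, fastforce, blast, blast, blast)

lemma tvp_relsE:
  assumes "(u, v) \<in> tvp_rels n"
  obtains
    (LL) i j k l where "u = pw [L i j, L k l]" "v = pw [L k l, L i j]"
      "distinct [i, j, k, l]" "{i, j, k, l} \<subseteq> {1..n}"
  | (LLL) i j k where "u = pw [L k i, L k j, L i j]" "v = pw [L i j, L k j, L k i]"
      "distinct [i, j, k]" "{i, j, k} \<subseteq> {1..n}"
  | (G2) i where "u = pw [G i, G i]" "v = []" "{i} \<subseteq> {1..n}"
  | (GG) i j where "u = pw [G i, G j]" "v = pw [G j, G i]" "i \<noteq> j" "{i, j} \<subseteq> {1..n}"
  | (LG) i j k where "u = pw [L i j, G k]" "v = pw [G k, L i j]"
      "distinct [i, j, k]" "{i, j, k} \<subseteq> {1..n}"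
  | (GLG) i j where "u = pw [L i j]" "v = pw [G i, G j, L j i, G j, G i]" "i \<noteq> j" "{i, j} \<subseteq> {1..n}"
  using assms unfolding tvp_rels_def by (elim UnE CollectE exE conjE) (blast, blast, simp, blast, blast, blast)

text \<open>The side conditions of the relations are distinctness and membership in
  \<open>{1..n}\<close>, both preserved by a permutation of \<open>{1..n}\<close>.\<close>

lemma relabel_word_rels:
  assumes "p permutes {1..n}" "(u, v) \<in> tvp_rels n"
  shows "(relabel_word p u, relabel_word p v) \<in> tvp_rels n"
proof -
  have inj: "p i = p j \<longleftrightarrow> i = j" for i j
    using permutes_inj[OF assms(1)] by (simp add: inj_eq)
  have pS: "p ` A \<subseteq> {1..n}" if "A \<subseteq> {1..n}" for A
    using that permutes_image[OF assms(1)] by blast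
  have pw: "relabel_word p (pw xs) = pw (map (relabel p) xs)" for xs
    by (simp add: pw_def)
  from assms(2) show ?thesis
  proof (cases rule: tvp_relsE)
    case (LL i j k l)
    then show ?thesis
      using tvp_relsI(1)[of "p i" "p j" "p k" "p l" n] pS[OF LL(4)] by (simp add: pw inj)
  next
    case (LLL i j k)
    then show ?thesis using tvp_relsI(2)[of "p i" "p j" "p k" n] pS[OF LLL(4)] by (simp add: pw inj)
  next
    case (G2 i)
    then show ?thesis using tvp_relsI(3)[of "p i" n] pS[OF G2(3)] by (simp add: pw)
  next
    case (GG i j)
    then show ?thesis using tvp_relsI(4)[of "p i" "p j" n] pS[OF GG(4)] by (simp add: pw inj)
  next
    case (LG i j k)
    then show ?thesis using tvp_relsI(5)[of "p i" "p j" "p k" n] pS[OF LG(4)] by (simp add: pw inj)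
  next
    case (GLG i j)
    then show ?thesis using tvp_relsI(6)[of "p i" "p j" n] pS[OF GLG(4)] by (simp add: pw inj)
  qed
qed

lemma relabel_word_pres_eq:
  assumes "p permutes {1..n}" "pres_eq (tvp_gens n) (tvp_rels n) u v"
  shows "pres_eq (tvp_gens n) (tvp_rels n) (relabel_word p u) (relabel_word p v)"
  using assms(2)
proof (rule pres_eq_substitution)
  fix x b assume "x \<in> tvp_gens n"
  then show "pres_eq (tvp_gens n) (tvp_rels n) (relabel_word p [(x, b), (x, \<not> b)]) []"
    using pres_eq.cancel[of "[]" _ "[]" "relabel p x" "tvp_rels n" b] relabel_gens[OF assms(1)] by simp
next
  fix l r assume "(l, r) \<in> tvp_rels n" "l \<in> words (tvp_gens n)" "r \<in> words (tvp_gens n)"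
  then show "pres_eq (tvp_gens n) (tvp_rels n) (relabel_word p l) (relabel_word p r)"
    using pres_eq.rel[OF relabel_word_rels[OF assms(1)], of l r "tvp_gens n" "[]" "[]"]
      relabel_word_words[OF assms(1)] by simp
qed (auto intro: relabel_word_words[OF assms(1)])

text \<open>
  \<open>coc\<close> is the \<open>P\<close>-component of the homomorphism \<open>TVB\<^sub>n \<rightarrow> P \<rtimes> S\<^sub>n\<close>, where \<open>P\<close> is the group presented
  by \<open>tvp_rels n\<close>, with \<open>\<sigma>\<^sub>i \<mapsto> (\<lambda>\<^bsub>i,i+1\<^esub>\<^sup>-\<^sup>1, (i,i+1))\<close>, \<open>\<rho>\<^sub>i \<mapsto> (1, (i,i+1))\<close> and \<open>\<gamma>\<^sub>j \<mapsto> (\<gamma>\<^sub>j, e)\<close>;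
  hence \<open>\<sigma>\<^sub>i\<^sup>-\<^sup>1 \<mapsto> (\<lambda>\<^bsub>i+1,i\<^esub>, (i,i+1))\<close>.
\<close>

fun coc_letter :: "tvb_gen \<times> bool \<Rightarrow> tvp_gen word" where
  "coc_letter (Sg i, b) = (if b then [(L (Suc i) i, False)] else [(L i (Suc i), True)])"
| "coc_letter (Rh i, b) = []"
| "coc_letter (Gm j, b) = [(G j, b)]"

fun coc :: "tvb_gen word \<Rightarrow> tvp_gen word" where
  "coc [] = []"
| "coc (a # w) = coc_letter a @ relabel_word (letter_perm a) (coc w)"

text \<open>The cocycle identity: the first component of a product in the semidirect
  product.\<close>

lemma coc_append: "coc (u @ v) = coc u @ relabel_word (word_perm u) (coc v)"
proof (induction u)
  case (Cons a u)
  then show ?case unfolding append_Cons coc.simps word_perm_Cons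
    by (simp only: map_append append_assoc relabel_word_comp)
qed (simp only: append_Nil coc.simps word_perm_Nil relabel_word_id)

lemma coc_words: "w \<in> words (tvb_gens n) \<Longrightarrow> coc w \<in> words (tvp_gens n)"
proof (induction w)
  case (Cons a w)
  have "coc_letter a \<in> words (tvp_gens n)"
    using Cons.prems by (cases a rule: coc_letter.cases) auto
  then show ?case using Cons by (auto intro!: relabel_word_words letter_perm_permutes)
qed simp

section \<open>The relations of P in the form in which the cocycle meets them\<close>

locale tvp_action = pres_action "tvp_gens n" "tvp_rels n" act
  for n and act :: "tvp_gen \<times> bool \<Rightarrow> 'a \<Rightarrow> 'a"
begin

lemma L_comm:
  assumes "distinct [i, j, k, l]" "{i, j, k, l} \<subseteq> {1..n}"
  shows "act (L i j, b) (act (L k l, b) y) = act (L k l, b) (act (L i j, b) y)"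
proof -
  have *: "(pw [L i j, L k l], pw [L k l, L i j]) \<in> tvp_rels n"
    using assms by (intro tvp_relsI)
  have **: "foldr act (pw [L i j, L k l]) y = foldr act (pw [L k l, L i j]) y" for y
    using assms by (intro act_rel[OF *]) (auto simp: pw_def)
  have "foldr act (winv (pw [L i j, L k l])) y = foldr act (winv (pw [L k l, L i j])) y"
    using assms by (intro foldr_act_winv_cong **) (auto simp: pw_def)
  then show ?thesis using **[of y] by (cases b) (auto simp: pw_def winv_def)
qed

lemma L_inverse_braid:
  assumes "distinct [i, j, k]" "{i, j, k} \<subseteq> {1..n}"
  shows "act (L i j, True) (act (L k j, True) (act (L k i, True) y)) =
         act (L k i, True) (act (L k j, True) (act (L i j, True) y))"
proof -
  have *: "(pw [L k i, L k j, L i j], pw [L i j, L k j, L k i]) \<in> tvp_rels n"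
    using assms by (intro tvp_relsI)
  have "foldr act (winv (pw [L k i, L k j, L i j])) y = foldr act (winv (pw [L i j, L k j, L k i])) y"
    using assms by (intro foldr_act_winv_cong act_rel[OF *]) (auto simp: pw_def)
  then show ?thesis by (auto simp: pw_def winv_def)
qed

lemma G_sq:
  assumes "i \<in> {1..n}"
  shows "act (G i, False) (act (G i, False) y) = y"
proof -
  have "(pw [G i, G i], []) \<in> tvp_rels n"
    using assms by (intro tvp_relsI) simp
  from act_rel[OF this, of y] show ?thesis using assms by (simp add: pw_def)
qed

lemma G_inverse: "i \<in> {1..n} \<Longrightarrow> act (G i, True) y = act (G i, False) y"
  by (rule act_involution_inverse) (simp_all add: G_sq)

text \<open>The case \<open>i = j\<close> is included because the corresponding relation in
  \<open>tvb_rels\<close> has no distinctness condition.\<close>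

lemma G_comm:
  assumes "i \<in> {1..n}" "j \<in> {1..n}"
  shows "act (G i, False) (act (G j, False) y) = act (G j, False) (act (G i, False) y)"
proof (cases "i = j")
  case False
  then have "(pw [G i, G j], pw [G j, G i]) \<in> tvp_rels n"
    using assms by (intro tvp_relsI) auto
  from act_rel[OF this, of y] show ?thesis using assms by (simp add: pw_def)
qed simp

lemma G_L_comm:
  assumes "distinct [i, j, k]" "{i, j, k} \<subseteq> {1..n}"
  shows "act (G k, False) (act (L i j, True) y) = act (L i j, True) (act (G k, False) y)"
proof -
  have *: "(pw [L i j, G k], pw [G k, L i j]) \<in> tvp_rels n"
    using assms by (intro tvp_relsI)
  have "foldr act (winv (pw [L i j, G k])) y = foldr act (winv (pw [G k, L i j])) y"
    using assms by (intro foldr_act_winv_cong act_rel[OF *]) (auto simp: pw_def)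
  then show ?thesis using assms by (auto simp: pw_def winv_def G_inverse)
qed

lemma L_inverse_swap:
  assumes "i \<noteq> j" "{i, j} \<subseteq> {1..n}"
  shows "act (L i j, True) y =
    act (G i, False) (act (G j, False) (act (L j i, True) (act (G i, False) (act (G j, False) y))))"
proof -
  have *: "(pw [L i j], pw [G i, G j, L j i, G j, G i]) \<in> tvp_rels n"
    using assms by (intro tvp_relsI)
  have "foldr act (winv (pw [L i j])) y = foldr act (winv (pw [G i, G j, L j i, G j, G i])) y"
    using assms by (intro foldr_act_winv_cong act_rel[OF *]) (auto simp: pw_def)
  then show ?thesis using assms by (auto simp: pw_def winv_def G_inverse G_comm[of i j])
qed

text \<open>Of the thirteen families of relations, eight become trivial under \<open>coc\<close>,
  once far transpositions fix the indices and \<open>G_sq\<close> is applied. The other five become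
  \<open>braid\<close>, \<open>comm\<close>, \<open>G_comm\<close>, \<open>mixed\<close> and
  \<open>swap\<close>.\<close>

lemma coc_rel:
  assumes "(l, r) \<in> tvb_rels n"
  shows "foldr act (coc l) y = foldr act (coc r) y"
proof -
  have far: "transpose i (Suc i) j = j" "transpose i (Suc i) (Suc j) = Suc j"
    "transpose j (Suc j) i = i" "transpose j (Suc j) (Suc i) = Suc i"
    if "Suc (Suc i) \<le> j \<or> Suc (Suc j) \<le> i" for i j
    using that by (auto simp: transpose_def)
  have braid: "act (L i (Suc i), True) (act (L i (Suc (Suc i)), True) (act (L (Suc i) (Suc (Suc i)), True) y)) =
      act (L (Suc i) (Suc (Suc i)), True) (act (L i (Suc (Suc i)), True) (act (L i (Suc i), True) y))"
    if "Suc 0 \<le> i" "i \<le> n - 2" for i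
    using that by (intro L_inverse_braid[symmetric]) auto
  have comm: "act (L i (Suc i), True) (act (L j (Suc j), True) y) =
      act (L j (Suc j), True) (act (L i (Suc i), True) y)"
    if "Suc 0 \<le> i" "i \<le> n - Suc 0" "Suc 0 \<le> j" "j \<le> n - Suc 0"
      "Suc (Suc i) \<le> j \<or> Suc (Suc j) \<le> i" for i j
    using that by (intro L_comm) auto
  have mixed: "act (G j, False) (act (L i (Suc i), True) y) = act (L i (Suc i), True) (act (G j, False) y)"
    if "Suc 0 \<le> i" "i \<le> n - Suc 0" "Suc 0 \<le> j" "j \<le> n" "j \<noteq> i" "j \<noteq> Suc i" for i j
    using that by (intro G_L_comm) auto
  \<comment> \<open>The last two letters stand in the opposite order to the relation of
    \<open>tvb_rels\<close>: they come after \<open>Sg i\<close>, whose transposition exchanges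
    their indices.\<close>
  have swap: "act (L (Suc i) i, True) y = act (G (Suc i), False) (act (G i, False)
      (act (L i (Suc i), True) (act (G (Suc i), False) (act (G i, False) y))))"
    if "Suc 0 \<le> i" "i \<le> n - Suc 0" for i
    using that by (intro L_inverse_swap) auto
  from assms show ?thesis
    unfolding tvb_rels_def pw_def
    apply (elim UnE CollectE exE conjE)
                apply (simp_all add: G_sq far)
        apply (rule braid; assumption)
       apply (rule comm; assumption)
      apply (simp add: G_comm)
     apply (rule mixed; assumption)
    apply (rule swap; assumption)
    done
qed

end

text \<open>As \<open>coc\<close> is only a crossed homomorphism,
  \<open>pres_eq_substitution\<close> does not apply and its induction is redone. The tail
  \<open>v\<close> is relabelled alike on both sides, since a cancelling pair has trivial
  permutation and the two sides of a relation have the same one.\<close>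

lemma coc_pres_eq:
  assumes "pres_eq (tvb_gens n) (tvb_rels n) u v"
  shows "pres_eq (tvp_gens n) (tvp_rels n) (coc u) (coc v)"
  using assms
proof induction
  case (refl w)
  then show ?case by (intro pres_eq.refl coc_words)
next
  case (sym u v)
  then show ?case by (blast intro: pres_eq.sym)
next
  case (trans u v w)
  then show ?case by (blast intro: pres_eq.trans)
next
  case (cancel u v x b)
  let ?eq = "pres_eq (tvp_gens n) (tvp_rels n)"
  let ?p = "word_perm u"
  have p: "?p permutes {1..n}" using cancel by (intro word_perm_permutes)
  have "?eq (coc [(x, b), (x, \<not> b)]) []"
  proof (cases x)
    \<comment> \<open>The transposition of the first letter swaps the indices in the image of the
      second, so the two images are mutually inverse letters.\<close>
    case (Sg i)
    then show ?thesis
      using cancel pres_eq.cancel[of "[]" "tvp_gens n" "[]" "L i (Suc i)" _ True]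
        pres_eq.cancel[of "[]" "tvp_gens n" "[]" "L (Suc i) i" _ False]
      by (cases b) auto
  next
    case (Rh i)
    then show ?thesis by (simp add: pres_eq.refl)
  next
    case (Gm j)
    then show ?thesis
      using cancel pres_eq.cancel[of "[]" "tvp_gens n" "[]" "G j" _ b] by (simp add: relabel_id)
  qed
  then have "?eq (relabel_word ?p (coc [(x, b), (x, \<not> b)])) []"
    using relabel_word_pres_eq[OF p] by fastforce
  then have "?eq (coc u @ relabel_word ?p (coc [(x, b), (x, \<not> b)]) @ relabel_word ?p (coc v))
      (coc u @ [] @ relabel_word ?p (coc v))"
    using cancel by (intro pres_eq_context relabel_word_words coc_words p)
  moreover have "word_perm (u @ [(x, b), (x, \<not> b)]) = ?p"
    by (simp only: word_perm_append word_perm_Cons word_perm_Nil letter_perm_involution comp_id)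
  ultimately show ?case
    using coc_append[of u v] coc_append[of u "[(x, b), (x, \<not> b)]"]
      coc_append[of "u @ [(x, b), (x, \<not> b)]" v]
    by (simp only: append_assoc append_Nil)
next
  case (rel l r u v)
  let ?eq = "pres_eq (tvp_gens n) (tvp_rels n)"
  let ?p = "word_perm u"
  have p: "?p permutes {1..n}" using rel by (intro word_perm_permutes)
  interpret tvp_action n "pact (tvp_gens n) (tvp_rels n)"
    by (simp add: tvp_action_def pres_action_pact)
  have "?eq (coc l) (coc r)"
    using rel coc_rel[OF rel(1)] by (simp add: foldr_pact_eq_iff[symmetric] coc_words fun_eq_iff)
  then have "?eq (relabel_word ?p (coc l)) (relabel_word ?p (coc r))"
    using relabel_word_pres_eq[OF p] by blast
  then have "?eq (coc u @ relabel_word ?p (coc l) @ relabel_word (?p \<circ> word_perm l) (coc v))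
      (coc u @ relabel_word ?p (coc r) @ relabel_word (?p \<circ> word_perm l) (coc v))"
    using rel by (intro pres_eq_context relabel_word_words coc_words p permutes_compose word_perm_permutes)
  then show ?case
    using word_perm_rel[OF rel(1)]
    by (simp only: coc_append map_append append_assoc relabel_word_comp)
qed

section \<open>Actions of the twisted virtual braid group\<close>

lemma tvb_relsI:
  "1 \<le> i \<Longrightarrow> i \<le> n - 2 \<Longrightarrow>
     (pw [Sg i, Sg (i+1), Sg i], pw [Sg (i+1), Sg i, Sg (i+1)]) \<in> tvb_rels n"
  "1 \<le> i \<Longrightarrow> i \<le> n - 1 \<Longrightarrow> 1 \<le> j \<Longrightarrow> j \<le> n - 1 \<Longrightarrow> i + 2 \<le> j \<or> j + 2 \<le> i \<Longrightarrow>
     (pw [Sg i, Sg j], pw [Sg j, Sg i]) \<in> tvb_rels n"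
  "1 \<le> i \<Longrightarrow> i \<le> n - 1 \<Longrightarrow> (pw [Rh i, Rh i], []) \<in> tvb_rels n"
  "1 \<le> i \<Longrightarrow> i \<le> n - 1 \<Longrightarrow> 1 \<le> j \<Longrightarrow> j \<le> n - 1 \<Longrightarrow> i + 2 \<le> j \<or> j + 2 \<le> i \<Longrightarrow>
     (pw [Rh i, Rh j], pw [Rh j, Rh i]) \<in> tvb_rels n"
  "1 \<le> i \<Longrightarrow> i \<le> n - 2 \<Longrightarrow>
     (pw [Rh i, Rh (i+1), Rh i], pw [Rh (i+1), Rh i, Rh (i+1)]) \<in> tvb_rels n"
  "1 \<le> i \<Longrightarrow> i \<le> n - 1 \<Longrightarrow> 1 \<le> j \<Longrightarrow> j \<le> n - 1 \<Longrightarrow> i + 2 \<le> j \<or> j + 2 \<le> i \<Longrightarrow>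
     (pw [Sg i, Rh j], pw [Rh j, Sg i]) \<in> tvb_rels n"
  "1 \<le> i \<Longrightarrow> i \<le> n - 2 \<Longrightarrow>
     (pw [Rh i, Rh (i+1), Sg i], pw [Sg (i+1), Rh i, Rh (i+1)]) \<in> tvb_rels n"
  "1 \<le> i \<Longrightarrow> i \<le> n \<Longrightarrow> (pw [Gm i, Gm i], []) \<in> tvb_rels n"
  "1 \<le> i \<Longrightarrow> i \<le> n \<Longrightarrow> 1 \<le> j \<Longrightarrow> j \<le> n \<Longrightarrow> (pw [Gm i, Gm j], pw [Gm j, Gm i]) \<in> tvb_rels n"
  "1 \<le> i \<Longrightarrow> i \<le> n - 1 \<Longrightarrow> 1 \<le> j \<Longrightarrow> j \<le> n \<Longrightarrow> j \<noteq> i \<Longrightarrow> j \<noteq> i + 1 \<Longrightarrow>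
     (pw [Gm j, Rh i], pw [Rh i, Gm j]) \<in> tvb_rels n"
  "1 \<le> i \<Longrightarrow> i \<le> n - 1 \<Longrightarrow> 1 \<le> j \<Longrightarrow> j \<le> n \<Longrightarrow> j \<noteq> i \<Longrightarrow> j \<noteq> i + 1 \<Longrightarrow>
     (pw [Gm j, Sg i], pw [Sg i, Gm j]) \<in> tvb_rels n"
  "1 \<le> i \<Longrightarrow> i \<le> n - 1 \<Longrightarrow> (pw [Rh i, Gm i], pw [Gm (i+1), Rh i]) \<in> tvb_rels n"
  "1 \<le> i \<Longrightarrow> i \<le> n - 1 \<Longrightarrow>
     (pw [Rh i, Sg i, Rh i], pw [Gm (i+1), Gm i, Sg i, Gm i, Gm (i+1)]) \<in> tvb_rels n"
  unfolding tvb_rels_def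
  by (((rule UnI2)?, rule CollectI, (rule exI)+, rule conjI, rule HOL.refl, (intro conjI; assumption))
      | rule UnI1)+

locale tvb_action = pres_action "tvb_gens n" "tvb_rels n" act
  for n and act :: "tvb_gen \<times> bool \<Rightarrow> 'a \<Rightarrow> 'a"
begin

abbreviation s :: "nat \<Rightarrow> 'a \<Rightarrow> 'a" where "s i \<equiv> act (Sg i, False)"
abbreviation s' :: "nat \<Rightarrow> 'a \<Rightarrow> 'a" where "s' i \<equiv> act (Sg i, True)"
abbreviation r :: "nat \<Rightarrow> 'a \<Rightarrow> 'a" where "r i \<equiv> act (Rh i, False)"
abbreviation g :: "nat \<Rightarrow> 'a \<Rightarrow> 'a" where "g j \<equiv> act (Gm j, False)"

lemma act_rel_pw:
  assumes "(pw u, pw v) \<in> tvb_rels n" "set u \<subseteq> tvb_gens n" "set v \<subseteq> tvb_gens n"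
  shows "foldr (\<lambda>x. act (x, False)) u y = foldr (\<lambda>x. act (x, False)) v y"
  using act_rel[OF assms(1), of y] assms(2,3)
  by (simp add: pw_def foldr_map o_def words_conv_set image_image)

lemma s_braid:
  assumes "1 \<le> i" "Suc i < n"
  shows "s i (s (Suc i) (s i y)) = s (Suc i) (s i (s (Suc i) y))"
proof -
  have "(pw [Sg i, Sg (i+1), Sg i], pw [Sg (i+1), Sg i, Sg (i+1)]) \<in> tvb_rels n"
    using assms by (intro tvb_relsI) auto
  from act_rel_pw[OF this, of y] show ?thesis using assms by simp
qed

lemma s_far:
  assumes "i \<in> {1..<n}" "j \<in> {1..<n}" "i + 2 \<le> j \<or> j + 2 \<le> i"
  shows "s i (s j y) = s j (s i y)"
proof -
  have "(pw [Sg i, Sg j], pw [Sg j, Sg i]) \<in> tvb_rels n"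
    using assms by (intro tvb_relsI) auto
  from act_rel_pw[OF this, of y] show ?thesis using assms by simp
qed

lemma r_sq [simp]:
  assumes "i \<in> {1..<n}"
  shows "r i (r i y) = y"
proof -
  have "(pw [Rh i, Rh i], pw []) \<in> tvb_rels n"
    using assms tvb_relsI(3)[of i n] by (auto simp: pw_def)
  from act_rel_pw[OF this, of y] show ?thesis using assms by simp
qed

lemma r_inverse: "i \<in> {1..<n} \<Longrightarrow> act (Rh i, True) y = r i y"
  by (rule act_involution_inverse) simp_all

lemma r_far:
  assumes "i \<in> {1..<n}" "j \<in> {1..<n}" "i + 2 \<le> j \<or> j + 2 \<le> i"
  shows "r i (r j y) = r j (r i y)"
proof -
  have "(pw [Rh i, Rh j], pw [Rh j, Rh i]) \<in> tvb_rels n"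
    using assms by (intro tvb_relsI) auto
  from act_rel_pw[OF this, of y] show ?thesis using assms by simp
qed

lemma r_braid:
  assumes "1 \<le> i" "Suc i < n"
  shows "r i (r (Suc i) (r i y)) = r (Suc i) (r i (r (Suc i) y))"
proof -
  have "(pw [Rh i, Rh (i+1), Rh i], pw [Rh (i+1), Rh i, Rh (i+1)]) \<in> tvb_rels n"
    using assms by (intro tvb_relsI) auto
  from act_rel_pw[OF this, of y] show ?thesis using assms by simp
qed

lemma s_r_far:
  assumes "i \<in> {1..<n}" "j \<in> {1..<n}" "i + 2 \<le> j \<or> j + 2 \<le> i"
  shows "s i (r j y) = r j (s i y)"
proof -
  have "(pw [Sg i, Rh j], pw [Rh j, Sg i]) \<in> tvb_rels n"
    using assms by (intro tvb_relsI) auto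
  from act_rel_pw[OF this, of y] show ?thesis using assms by simp
qed

lemma r_r_s:
  assumes "1 \<le> i" "Suc i < n"
  shows "r i (r (Suc i) (s i y)) = s (Suc i) (r i (r (Suc i) y))"
proof -
  have "(pw [Rh i, Rh (i+1), Sg i], pw [Sg (i+1), Rh i, Rh (i+1)]) \<in> tvb_rels n"
    using assms by (intro tvb_relsI) auto
  from act_rel_pw[OF this, of y] show ?thesis using assms by simp
qed

lemma g_sq [simp]:
  assumes "i \<in> {1..n}"
  shows "g i (g i y) = y"
proof -
  have "(pw [Gm i, Gm i], pw []) \<in> tvb_rels n"
    using assms tvb_relsI(8)[of i n] by (auto simp: pw_def)
  from act_rel_pw[OF this, of y] show ?thesis using assms by simp
qed

lemma g_inverse: "i \<in> {1..n} \<Longrightarrow> act (Gm i, True) y = g i y"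
  by (rule act_involution_inverse) simp_all

lemma g_comm:
  assumes "i \<in> {1..n}" "j \<in> {1..n}"
  shows "g i (g j y) = g j (g i y)"
proof -
  have "(pw [Gm i, Gm j], pw [Gm j, Gm i]) \<in> tvb_rels n"
    using assms by (intro tvb_relsI) auto
  from act_rel_pw[OF this, of y] show ?thesis using assms by simp
qed

lemma g_r_far:
  assumes "i \<in> {1..<n}" "j \<in> {1..n}" "j \<noteq> i" "j \<noteq> Suc i"
  shows "g j (r i y) = r i (g j y)"
proof -
  have "(pw [Gm j, Rh i], pw [Rh i, Gm j]) \<in> tvb_rels n"
    using assms by (intro tvb_relsI) auto
  from act_rel_pw[OF this, of y] show ?thesis using assms by simp
qed

lemma g_s_far:
  assumes "i \<in> {1..<n}" "j \<in> {1..n}" "j \<noteq> i" "j \<noteq> Suc i"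
  shows "g j (s i y) = s i (g j y)"
proof -
  have "(pw [Gm j, Sg i], pw [Sg i, Gm j]) \<in> tvb_rels n"
    using assms by (intro tvb_relsI) auto
  from act_rel_pw[OF this, of y] show ?thesis using assms by simp
qed

lemma r_g:
  assumes "i \<in> {1..<n}"
  shows "r i (g i y) = g (Suc i) (r i y)"
proof -
  have "(pw [Rh i, Gm i], pw [Gm (i+1), Rh i]) \<in> tvb_rels n"
    using assms by (intro tvb_relsI) auto
  from act_rel_pw[OF this, of y] show ?thesis using assms by simp
qed

lemma r_s_r:
  assumes "i \<in> {1..<n}"
  shows "r i (s i (r i y)) = g (Suc i) (g i (s i (g i (g (Suc i) y))))"
proof -
  have "(pw [Rh i, Sg i, Rh i], pw [Gm (i+1), Gm i, Sg i, Gm i, Gm (i+1)]) \<in> tvb_rels n"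
    using assms by (intro tvb_relsI) auto
  from act_rel_pw[OF this, of y] show ?thesis using assms by simp
qed

section \<open>Relations involving inverses of the \<sigma>\<close>

lemma s'_braid:
  assumes "1 \<le> i" "Suc i < n"
  shows "s' i (s' (Suc i) (s' i y)) = s' (Suc i) (s' i (s' (Suc i) y))"
proof -
  \<comment> \<open>Both sides equal \<open>z\<close>: by \<open>s_braid\<close>, the two composites
    of inverses undo the same element.\<close>
  have "s' i (s' (Suc i) (s' i (s i (s (Suc i) (s i z))))) =
        s' (Suc i) (s' i (s' (Suc i) (s i (s (Suc i) (s i z)))))" for z
    using assms by (subst (2) s_braid) simp_all
  from this[of "s' i (s' (Suc i) (s' i y))"] show ?thesis using assms by simp
qed

lemma s'_far:
  assumes "i \<in> {1..<n}" "j \<in> {1..<n}" "i + 2 \<le> j \<or> j + 2 \<le> i"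
  shows "s' i (s' j y) = s' j (s' i y)"
proof -
  have "s j (s i (s' i (s' j y))) = s j (s i (s' j (s' i y)))"
    using assms by (subst (2) s_far[OF assms, symmetric]) simp
  then show ?thesis using assms by (simp only: act_inj tvb_gens_simps)
qed

lemma s'_r_far:
  assumes "i \<in> {1..<n}" "j \<in> {1..<n}" "i + 2 \<le> j \<or> j + 2 \<le> i"
  shows "r j (s' i y) = s' i (r j y)"
proof -
  have "s i (s' i (r j y)) = s i (r j (s' i y))" using assms by (simp add: s_r_far)
  then show ?thesis using assms by (simp only: act_inj tvb_gens_simps)
qed

lemma r_r_s':
  assumes "1 \<le> i" "Suc i < n"
  shows "r i (r (Suc i) (s' i y)) = s' (Suc i) (r i (r (Suc i) y))"
proof -
  have "s (Suc i) (r i (r (Suc i) (s' i y))) = s (Suc i) (s' (Suc i) (r i (r (Suc i) y)))"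
    using assms by (simp add: r_r_s[symmetric])
  then show ?thesis using assms by (subst (asm) act_inj) simp_all
qed

lemma s'_r_r:
  assumes "1 \<le> i" "Suc i < n"
  shows "s' i (r (Suc i) (r i y)) = r (Suc i) (r i (s' (Suc i) y))"
  using arg_cong[OF r_r_s'[OF assms, of "r (Suc i) (r i y)"], of "\<lambda>z. r (Suc i) (r i z)"] assms
  by simp

lemma g_s'_far:
  assumes "i \<in> {1..<n}" "j \<in> {1..n}" "j \<noteq> i" "j \<noteq> Suc i"
  shows "g j (s' i y) = s' i (g j y)"
proof -
  have "s i (g j (s' i y)) = s i (s' i (g j y))"
    using assms by (simp add: g_s_far[symmetric])
  then show ?thesis using assms by (simp only: act_inj tvb_gens_simps)
qed

lemma r_s'_r:
  assumes "i \<in> {1..<n}"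
  shows "r i (s' i (r i y)) = g (Suc i) (g i (s' i (g i (g (Suc i) y))))"
proof -
  have "r i (s i (r i (r i (s' i (r i y))))) = y" using assms by simp
  moreover have "r i (s i (r i (g (Suc i) (g i (s' i (g i (g (Suc i) y))))))) = y"
    using assms by (subst r_s_r) simp_all
  ultimately have "r i (s i (r i (r i (s' i (r i y))))) =
      r i (s i (r i (g (Suc i) (g i (s' i (g i (g (Suc i) y)))))))"
    by (rule HOL.trans[OF _ HOL.sym])
  then show ?thesis using assms by (simp only: act_inj tvb_gens_simps)
qed

lemma r_g':
  assumes "i \<in> {1..<n}"
  shows "r i (g (Suc i) y) = g i (r i y)"
  using arg_cong[OF r_g[OF assms, of "r i y"], of "r i"] assms by simp

lemma r_g_transpose:
  assumes "m \<in> {1..<n}" "j \<in> {1..n}"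
  shows "r m (g j y) = g (transpose m (Suc m) j) (r m y)"
  using assms r_g r_g' g_r_far[of m j] by (cases "j = m"; cases "j = Suc m") auto

definition chain :: "(nat \<Rightarrow> 'a \<Rightarrow> 'a) \<Rightarrow> nat \<Rightarrow> nat \<Rightarrow> 'a \<Rightarrow> 'a"
  where "chain x i j y = foldr r (rev [Suc i..<j]) (x i (foldr r [Suc i..<j] y))"

text \<open>
  The two families to which this is applied are \<open>\<lambda>\<^bsub>i,i+1\<^esub>\<close> and \<open>\<lambda>\<^bsub>i+1,i\<^esub>\<close>;
  they are exchanged by \<open>\<rho>\<^sub>i\<close>, the one case that the next lemmas leave out.
\<close>

context
  fixes x :: "nat \<Rightarrow> 'a \<Rightarrow> 'a"
  assumes x_far: "\<And>i j y. i \<in> {1..<n} \<Longrightarrow> j \<in> {1..<n} \<Longrightarrow> i + 2 \<le> j \<or> j + 2 \<le> i \<Longrightarrow>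
      r j (x i y) = x i (r j y)"
    and x_shift: "\<And>i y. 1 \<le> i \<Longrightarrow> Suc i < n \<Longrightarrow>
      r i (r (Suc i) (x i y)) = x (Suc i) (r i (r (Suc i) y))"
begin

lemma chain_base: "chain x i (Suc i) y = x i y"
  by (simp add: chain_def)

lemma chain_Suc: "i < j \<Longrightarrow> chain x i (Suc j) y = r j (chain x i j (r j y))"
  by (simp add: chain_def)

lemma chain_outside:
  assumes "i < j" "1 \<le> i" "j \<le> n" "m \<in> {1..<n}" "j < m \<or> Suc m < i"
  shows "r m (chain x i j y) = chain x i j (r m y)"
proof -
  have "Suc i \<le> j" using assms by simp
  then show ?thesis
    using assms
  proof (induction j arbitrary: y rule: dec_induct)
    case base
    then show ?case by (auto simp: chain_base x_far)
  next
    case (step j)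
    then have "r m (r j z) = r j (r m z)" for z by (intro r_far) auto
    with step show ?case by (auto simp: chain_Suc)
  qed
qed

lemma chain_inside:
  assumes "i < m" "Suc m < j" "1 \<le> i" "j \<le> n"
  shows "r m (chain x i j y) = chain x i j (r m y)"
proof -
  have "Suc (Suc m) \<le> j" using assms by simp
  then show ?thesis
    using assms
  proof (induction j arbitrary: y rule: dec_induct)
    case base
    have "r m (chain x i (Suc (Suc m)) y) = r m (r (Suc m) (r m (chain x i m (r m (r (Suc m) y)))))"
      using base by (simp add: chain_Suc)
    also have "\<dots> = r (Suc m) (r m (r (Suc m) (chain x i m (r m (r (Suc m) y)))))"
      using base by (intro r_braid) auto
    also have "\<dots> = r (Suc m) (r m (chain x i m (r (Suc m) (r m (r (Suc m) y)))))"
      using base by (subst chain_outside) auto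
    also have "\<dots> = r (Suc m) (r m (chain x i m (r m (r (Suc m) (r m y)))))"
      using base by (subst r_braid) auto
    also have "\<dots> = chain x i (Suc (Suc m)) (r m y)"
      using base by (simp add: chain_Suc)
    finally show ?case .
  next
    case (step j)
    then have "r m (r j z) = r j (r m z)" for z by (intro r_far) auto
    with step show ?case by (simp add: chain_Suc)
  qed
qed

lemma chain_shift:
  assumes "1 \<le> i" "Suc i < j" "j \<le> n"
  shows "r i (chain x i j y) = chain x (Suc i) j (r i y)"
proof -
  have "Suc (Suc i) \<le> j" using assms by simp
  then show ?thesis
    using assms
  proof (induction j arbitrary: y rule: dec_induct)
    case base
    then show ?case by (simp add: chain_Suc chain_base x_shift)
  next
    case (step j)
    then have "r i (r j z) = r j (r i z)" for z by (intro r_far) auto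
    with step show ?case by (simp add: chain_Suc)
  qed
qed

lemma chain_conj:
  assumes "m \<in> {1..<n}" "1 \<le> i" "i < j" "j \<le> n" "m \<noteq> i \<or> j \<noteq> Suc i"
  shows "r m (chain x i j y) = chain x (transpose m (Suc m) i) (transpose m (Suc m) j) (r m y)"
proof -
  consider "j < m \<or> Suc m < i" | "j = m" | "Suc m = j" "i < m" | "i < m" "Suc m < j"
    | "m = i" "Suc i < j" | "Suc m = i"
    using assms by linarith
  then show ?thesis
  proof cases
    case 1
    then show ?thesis using assms chain_outside[of i j m y] by auto
  next
    case 2
    then show ?thesis using assms by (simp add: chain_Suc)
  next
    case 3
    then show ?thesis using assms by (auto simp: chain_Suc)
  next
    case 4
    then show ?thesis using assms chain_inside[of i m j y] by simp
  next
    case 5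
    then show ?thesis using assms chain_shift[of i j y] by simp
  next
    case 6
    then show ?thesis using assms arg_cong[OF chain_shift[of m j "r m y"], of "r m"] by auto
  qed
qed

end

abbreviation lam :: "nat \<Rightarrow> nat \<Rightarrow> 'a \<Rightarrow> 'a" where "lam k l \<equiv> foldr act (lam_word k l)"

lemma lam_less: "k < l \<Longrightarrow> lam k l y = chain (\<lambda>i y. r i (s' i y)) k l y"
  by (simp add: lam_word_def chain_def rho_chain_def pw_def rev_map foldr_map o_def)

lemma lam_greater: "l < k \<Longrightarrow> lam k l y = chain (\<lambda>i y. r i (r i (s' i (r i y)))) l k y"
  by (simp add: lam_word_def chain_def rho_chain_def pw_def rev_map foldr_map o_def)

lemma r_lam:
  assumes "m \<in> {1..<n}" "k \<in> {1..n}" "l \<in> {1..n}" "k \<noteq> l"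
  shows "r m (lam k l y) = lam (transpose m (Suc m) k) (transpose m (Suc m) l) (r m y)"
proof -
  let ?t = "transpose m (Suc m)"
  have mono: "?t i < ?t j" if "i < j" "m \<noteq> i \<or> j \<noteq> Suc i" for i j
    using that by (auto simp: transpose_def)
  consider "k < l" "m \<noteq> k \<or> l \<noteq> Suc k" | "l < k" "m \<noteq> l \<or> k \<noteq> Suc l"
    | "k = m" "l = Suc m" | "k = Suc m" "l = m"
    using assms by linarith
  then show ?thesis
  proof cases
    case 1
    have "r m (chain (\<lambda>i y. r i (s' i y)) k l y) = chain (\<lambda>i y. r i (s' i y)) (?t k) (?t l) (r m y)"
    proof (rule chain_conj)
      show "r i (r (Suc i) (r i (s' i z))) = r (Suc i) (s' (Suc i) (r i (r (Suc i) z)))"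
        if "1 \<le> i" "Suc i < n" for i z
        using that by (simp add: r_braid r_r_s')
    qed (use assms 1 in \<open>auto simp: s'_r_far r_far\<close>)
    then show ?thesis using 1 mono by (simp add: lam_less)
  next
    case 2
    let ?x = "\<lambda>i y. r i (r i (s' i (r i y)))"
    have "r m (chain ?x l k y) = chain ?x (?t l) (?t k) (r m y)"
    proof (rule chain_conj)
      show "r i (r (Suc i) (?x i z)) = ?x (Suc i) (r i (r (Suc i) z))"
        if "1 \<le> i" "Suc i < n" for i z
        using that by (simp add: r_braid r_r_s')
      show "r j (?x i z) = ?x i (r j z)"
        if "i \<in> {1..<n}" "j \<in> {1..<n}" "i + 2 \<le> j \<or> j + 2 \<le> i" for i j z
        using that r_far[of i j] s'_r_far[of i j] by simp
    qed (use assms 2 in auto)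
    then show ?thesis using 2 mono by (simp add: lam_greater)
  next
    case 3
    then show ?thesis using assms by (simp add: lam_less lam_greater chain_def)
  next
    case 4
    then show ?thesis using assms by (simp add: lam_less lam_greater chain_def)
  qed
qed

lemma foldr_r_far:
  assumes "set js \<subseteq> {1..<n}" "i \<in> {1..<n}" "\<And>j. j \<in> set js \<Longrightarrow> i + 2 \<le> j \<or> j + 2 \<le> i"
  shows "foldr r js (r i y) = r i (foldr r js y)"
  using assms
proof (induction js)
  case (Cons j js)
  then have "r j (r i z) = r i (r j z)" for z by (intro r_far) auto
  with Cons show ?case by simp
qed simp

lemma descending_chain_mult:
  assumes "m < n" "k \<in> {1..Suc m}" "j \<in> {1..m}"
  shows "\<exists>us k'. set us \<subseteq> {1..<m} \<and> k' \<in> {1..Suc m} \<and>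
    (\<forall>y. foldr r (rev [k..<Suc m]) (r j y) = foldr r us (foldr r (rev [k'..<Suc m]) y))"
proof -
  consider "k = Suc j" | "k = j" | "Suc j < k" | "k < j" by linarith
  then show ?thesis
  proof cases
    case 1
    then show ?thesis using assms
      by (intro exI[of _ "[]"] exI[of _ j]) (simp add: upt_conv_Cons[of j] del: upt_Suc)
  next
    case 2
    then show ?thesis using assms
      by (intro exI[of _ "[]"] exI[of _ "Suc k"]) (simp add: upt_conv_Cons[of j] del: upt_Suc)
  next
    case 3
    then have "foldr r (rev [k..<Suc m]) (r j y) = r j (foldr r (rev [k..<Suc m]) y)" for y
      using assms by (intro foldr_r_far) auto
    with 3 assms show ?thesis by (intro exI[of _ "[j]"] exI[of _ k]) (auto simp del: upt_Suc)
  next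
    case 4
    then obtain i where i: "j = Suc i" "k \<le> i" by (cases j) auto
    have "[k..<Suc m] = [k..<i] @ i # Suc i # [Suc (Suc i)..<Suc m]"
      using i assms upt_add_eq_append[of k i "Suc m - i"]
      by (simp add: upt_conv_Cons[of i "Suc m"] upt_conv_Cons[of "Suc i" "Suc m"] del: upt_Suc)
    then have split: "foldr r (rev [k..<Suc m]) y =
        foldr r (rev [Suc (Suc i)..<Suc m]) (r (Suc i) (r i (foldr r (rev [k..<i]) y)))" for y
      by (simp del: upt_Suc)
    have far1: "foldr r (rev [k..<i]) (r (Suc i) y) = r (Suc i) (foldr r (rev [k..<i]) y)" for y
      using i assms by (intro foldr_r_far) auto
    have far2: "foldr r (rev [Suc (Suc i)..<Suc m]) (r i y) = r i (foldr r (rev [Suc (Suc i)..<Suc m]) y)" for y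
      using i assms by (intro foldr_r_far) auto
    have "foldr r (rev [k..<Suc m]) (r j y) = r i (foldr r (rev [k..<Suc m]) y)" for y
      using i assms by (simp add: split far1 far2[symmetric] r_braid del: upt_Suc)
    with i assms show ?thesis by (intro exI[of _ "[i]"] exI[of _ k]) (auto simp del: upt_Suc)
  qed
qed

lemma descending_chain_normal_form:
  assumes "m < n" "set js \<subseteq> {1..m}"
  shows "\<exists>us k. set us \<subseteq> {1..<m} \<and> k \<in> {1..Suc m} \<and>
    (\<forall>y. foldr r js y = foldr r us (foldr r (rev [k..<Suc m]) y))"
  using assms(2)
proof (induction js rule: rev_induct)
  case Nil
  then show ?case by (intro exI[of _ "[]"] exI[of _ "Suc m"]) simp
next
  case (snoc j js)
  then obtain us k where 1: "set us \<subseteq> {1..<m}" "k \<in> {1..Suc m}"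
    "\<And>y. foldr r js y = foldr r us (foldr r (rev [k..<Suc m]) y)" by auto
  from snoc.prems have "j \<in> {1..m}" by simp
  with descending_chain_mult[OF assms(1) 1(2)] obtain us' k' where
    "set us' \<subseteq> {1..<m}" "k' \<in> {1..Suc m}"
    "\<And>y. foldr r (rev [k..<Suc m]) (r j y) = foldr r us' (foldr r (rev [k'..<Suc m]) y)" by blast
  with 1 show ?case by (intro exI[of _ "us @ us'"] exI[of _ k']) (simp del: upt_Suc)
qed

end

section \<open>The elements \<open>\<lambda>\<^bsub>kl\<^esub>\<close>\<close>

definition rho_word :: "nat list \<Rightarrow> tvb_gen word"
  where "rho_word js = pw (map Rh js)"

lemma rho_word_simps [simp]:
  "rho_word [] = []"
  "rho_word (j # js) = (Rh j, False) # rho_word js"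
  "rho_word (es @ js) = rho_word es @ rho_word js"
  by (simp_all add: rho_word_def pw_def)

lemma rho_word_words [simp]: "rho_word js \<in> words (tvb_gens n) \<longleftrightarrow> set js \<subseteq> {1..<n}"
  by (induction js) auto

lemma rho_word_transpose:
  assumes "a \<in> {1..n}" "b \<in> {1..n}"
  shows "\<exists>js. set js \<subseteq> {1..<n} \<and> word_perm (rho_word js) = transpose a b"
proof -
  have less: "\<exists>js. set js \<subseteq> {1..<n} \<and> word_perm (rho_word js) = transpose a b"
    if "Suc a \<le> b" "1 \<le> a" "b \<le> n" for a b
    using that
  proof (induction b rule: dec_induct)
    case base
    then show ?case by (intro exI[of _ "[a]"]) simp
  next
    case (step b)
    then obtain js where js: "set js \<subseteq> {1..<n}" "word_perm (rho_word js) = transpose a b" by auto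
    have "transpose b (Suc b) \<circ> (transpose a b \<circ> transpose b (Suc b)) = transpose a (Suc b)"
      using step by (auto simp: fun_eq_iff transpose_def)
    then have "word_perm (rho_word (b # js @ [b])) = transpose a (Suc b)"
      by (simp only: rho_word_simps word_perm_Cons word_perm_append word_perm_Nil js letter_perm.simps
          comp_id Suc_eq_plus1)
    then show ?case using js step by (intro exI[of _ "b # js @ [b]"]) auto
  qed
  consider "a < b" | "a = b" | "b < a" by linarith
  then show ?thesis
  proof cases
    case 1
    then show ?thesis using less[of a b] assms by auto
  next
    case 2
    then show ?thesis by (intro exI[of _ "[]"]) simp
  next
    case 3
    then show ?thesis using less[of b a] assms by (auto simp: transpose_commute)
  qed
qed

lemma rho_word_tuple:
  assumes "distinct ks" "set ks \<subseteq> {1..n}"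
  shows "\<exists>js. set js \<subseteq> {1..<n} \<and> (\<forall>a<length ks. word_perm (rho_word js) (Suc a) = ks ! a)"
  using assms
proof (induction ks rule: rev_induct)
  case Nil
  then show ?case by (intro exI[of _ "[]"]) simp
next
  case (snoc k ks)
  then obtain js where js: "set js \<subseteq> {1..<n}"
    "\<And>a. a < length ks \<Longrightarrow> word_perm (rho_word js) (Suc a) = ks ! a" by auto
  let ?p = "word_perm (rho_word js)"
  let ?q = "?p (Suc (length ks))"
  have p: "?p permutes {1..n}" using js by (intro word_perm_permutes) simp
  have "length (ks @ [k]) \<le> n"
    using distinct_card[OF snoc.prems(1)] card_mono[OF _ snoc.prems(2)] by simp
  then have "?q \<in> {1..n}" using permutes_in_image[OF p, of "Suc (length ks)"] by simp
  then obtain es where es: "set es \<subseteq> {1..<n}" "word_perm (rho_word es) = transpose ?q k"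
    using rho_word_transpose[of ?q n k] snoc.prems by auto
  have "word_perm (rho_word (es @ js)) (Suc a) = (ks @ [k]) ! a" if "a < length (ks @ [k])" for a
  proof (cases "a = length ks")
    case True
    then show ?thesis by (simp add: es)
  next
    case False
    then have a: "a < length ks" using that by simp
    then have "ks ! a \<noteq> ?q"
      using js(2)[OF a] permutes_inj[OF p] by (metis Suc_inject False injD)
    moreover have "ks ! a \<noteq> k" using snoc.prems a by auto
    ultimately show ?thesis using a js(2)[OF a] by (simp add: es nth_append)
  qed
  then show ?case using es js by (intro exI[of _ "es @ js"]) auto
qed

lemma lam_word_words [simp]:
  assumes "k \<in> {1..n}" "l \<in> {1..n}" "k \<noteq> l"
  shows "lam_word k l \<in> words (tvb_gens n)"
proof -
  have "rho_chain i j \<in> words (tvb_gens n)" if "j \<le> n" for i j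
    using that rho_word_words[of "rev [i+1..<j]" n] by (auto simp: rho_word_def rho_chain_def)
  then show ?thesis using assms by (auto simp: lam_word_def)
qed

fun lam_sub_letter :: "tvp_gen \<times> bool \<Rightarrow> tvb_gen word" where
  "lam_sub_letter (L k l, b) = (if b then winv (lam_word k l) else lam_word k l)"
| "lam_sub_letter (G j, b) = [(Gm j, b)]"

definition lam_sub :: "tvp_gen word \<Rightarrow> tvb_gen word"
  where "lam_sub w = concat (map lam_sub_letter w)"

lemma lam_sub_simps [simp]:
  "lam_sub [] = []"
  "lam_sub (a # w) = lam_sub_letter a @ lam_sub w"
  "lam_sub (u @ v) = lam_sub u @ lam_sub v"
  by (simp_all add: lam_sub_def)

lemma lam_sub_letter_words: "fst a \<in> tvp_gens n \<Longrightarrow> lam_sub_letter a \<in> words (tvb_gens n)"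
  by (cases a rule: lam_sub_letter.cases) auto

lemma lam_sub_words: "w \<in> words (tvp_gens n) \<Longrightarrow> lam_sub w \<in> words (tvb_gens n)"
  by (induction w) (auto simp: lam_sub_letter_words)

fun rho_letter :: "tvb_gen \<times> bool \<Rightarrow> nat list" where
  "rho_letter (Sg i, b) = [i]"
| "rho_letter (Rh i, b) = [i]"
| "rho_letter (Gm j, b) = []"

definition rho_part :: "tvb_gen word \<Rightarrow> nat list"
  where "rho_part w = concat (map rho_letter w)"

lemma rho_part_simps [simp]:
  "rho_part [] = []"
  "rho_part (a # w) = rho_letter a @ rho_part w"
  by (simp_all add: rho_part_def)

lemma rho_part_set: "w \<in> words (tvb_gens n) \<Longrightarrow> set (rho_part w) \<subseteq> {1..<n}"
proof (induction w)
  case (Cons a w)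
  then show ?case by (cases a rule: rho_letter.cases) auto
qed simp

lemma word_perm_rho_part: "word_perm (rho_word (rho_part w)) = word_perm w"
proof (induction w)
  case (Cons a w)
  then show ?case by (cases a rule: rho_letter.cases) auto
qed simp

context tvb_action
begin

lemma foldr_act_rho_word: "foldr act (rho_word js) y = foldr r js y"
  by (induction js) auto

lemma foldr_r_rev: "set js \<subseteq> {1..<n} \<Longrightarrow> foldr r js (foldr r (rev js) y) = y"
  by (induction js arbitrary: y) auto

lemma foldr_r_lam:
  assumes "set js \<subseteq> {1..<n}" "k \<in> {1..n}" "l \<in> {1..n}" "k \<noteq> l"
  shows "foldr r js (lam k l y) =
    lam (word_perm (rho_word js) k) (word_perm (rho_word js) l) (foldr r js y)"
  using assms(1)
proof (induction js)
  case (Cons j js)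
  let ?p = "word_perm (rho_word js)"
  have p: "?p permutes {1..n}" using Cons by (intro word_perm_permutes) simp
  have "?p k \<in> {1..n}" "?p l \<in> {1..n}" "?p k \<noteq> ?p l"
    using permutes_in_image[OF p] permutes_inj[OF p] assms by (auto simp: inj_eq simp del: atLeastAtMost_iff)
  then show ?case using Cons r_lam[of j "?p k" "?p l"] by simp
qed simp

lemma foldr_r_g:
  assumes "set js \<subseteq> {1..<n}" "k \<in> {1..n}"
  shows "foldr r js (g k y) = g (word_perm (rho_word js) k) (foldr r js y)"
  using assms(1)
proof (induction js)
  case (Cons j js)
  let ?p = "word_perm (rho_word js)"
  have p: "?p permutes {1..n}" using Cons by (intro word_perm_permutes) simp
  have "?p k \<in> {1..n}" using permutes_in_image[OF p] assms by blast
  then show ?case using Cons r_g_transpose[of j "?p k"] by simp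
qed simp

lemma lam_base:
  "lam 1 2 y = r 1 (s' 1 y)" "lam 2 3 y = r 2 (s' 2 y)" "lam 3 4 y = r 3 (s' 3 y)"
  "lam 1 3 y = r 2 (r 1 (s' 1 (r 2 y)))" "lam 2 1 y = r 1 (r 1 (s' 1 (r 1 y)))"
  by (simp_all add: lam_word_def rho_chain_def pw_def upt_rec numeral_eq_Suc)

lemma lam_comm:
  assumes "distinct [i, j, k, l]" "{i, j, k, l} \<subseteq> {1..n}"
  shows "lam i j (lam k l y) = lam k l (lam i j y)"
proof -
  have n: "4 \<le> n" using card_mono[OF _ assms(2)] assms(1) by simp
  obtain js where js: "set js \<subseteq> {1..<n}"
    and a: "\<forall>a<4. word_perm (rho_word js) (Suc a) = [i, j, k, l] ! a"
    using rho_word_tuple[OF assms(1), of n] assms(2) by auto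
  have p: "word_perm (rho_word js) 1 = i" "word_perm (rho_word js) 2 = j"
    "word_perm (rho_word js) 3 = k" "word_perm (rho_word js) 4 = l"
    using a[rule_format, of 0] a[rule_format, of 1] a[rule_format, of 2] a[rule_format, of 3]
    by (simp_all add: numeral_eq_Suc)
  have 12: "foldr r js (lam 1 2 y) = lam i j (foldr r js y)" for y
    using foldr_r_lam[OF js, of 1 2 y] n p by simp
  have 34: "foldr r js (lam 3 4 y) = lam k l (foldr r js y)" for y
    using foldr_r_lam[OF js, of 3 4 y] n p by simp
  have "lam 1 2 (lam 3 4 z) = lam 3 4 (lam 1 2 z)" for z
    using n by (simp add: lam_base s'_far[of 1 3] s'_r_far[of 1 3, symmetric] s'_r_far[of 3 1] r_far[of 1 3] del: One_nat_def)
  then have "lam i j (lam k l (foldr r js z)) = lam k l (lam i j (foldr r js z))" for z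
    by (metis 12 34)
  then show ?thesis using foldr_r_rev[OF js] by metis
qed

lemma lam_braid:
  assumes "distinct [i, j, k]" "{i, j, k} \<subseteq> {1..n}"
  shows "lam k i (lam k j (lam i j y)) = lam i j (lam k j (lam k i y))"
proof -
  have n: "3 \<le> n" using card_mono[OF _ assms(2)] assms(1) by simp
  obtain js where js: "set js \<subseteq> {1..<n}"
    and a: "\<forall>a<3. word_perm (rho_word js) (Suc a) = [k, i, j] ! a"
    using rho_word_tuple[of "[k, i, j]" n] assms by auto
  have p: "word_perm (rho_word js) 1 = k" "word_perm (rho_word js) 2 = i"
    "word_perm (rho_word js) 3 = j"
    using a[rule_format, of 0] a[rule_format, of 1] a[rule_format, of 2]
    by (simp_all add: numeral_eq_Suc)
  have 12: "foldr r js (lam 1 2 y) = lam k i (foldr r js y)" for y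
    using foldr_r_lam[OF js, of 1 2 y] n p by simp
  have 13: "foldr r js (lam 1 3 y) = lam k j (foldr r js y)" for y
    using foldr_r_lam[OF js, of 1 3 y] n p by simp
  have 23: "foldr r js (lam 2 3 y) = lam i j (foldr r js y)" for y
    using foldr_r_lam[OF js, of 2 3 y] n p by simp
  have rr: "r 1 (r 2 (r 1 y)) = r 2 (r 1 (r 2 y))" for y using r_braid[of 1 y] n by (simp del: One_nat_def)
  have ss: "s' 1 (s' 2 (s' 1 y)) = s' 2 (s' 1 (s' 2 y))" for y using s'_braid[of 1 y] n by (simp del: One_nat_def)
  have rs: "r 1 (r 2 (s' 1 y)) = s' 2 (r 1 (r 2 y))" for y using r_r_s'[of 1 y] n by (simp del: One_nat_def)
  have sr: "s' 1 (r 2 (r 1 y)) = r 2 (r 1 (s' 2 y))" for y using s'_r_r[of 1 y] n by (simp del: One_nat_def)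
  have sq: "r 1 (r 1 y) = y" "r 2 (r 2 y) = y" for y using n by simp_all
  have "lam 1 2 (lam 1 3 (lam 2 3 z)) = lam 2 3 (lam 1 3 (lam 1 2 z))" for z
  proof -
    have "lam 1 2 (lam 1 3 (lam 2 3 z)) = r 1 (r 2 (r 1 (s' 2 (s' 1 (s' 2 z)))))"
      by (simp only: lam_base sq sr)
    also have "\<dots> = r 2 (r 1 (r 2 (s' 1 (s' 2 (s' 1 z)))))"
      by (simp only: rr ss)
    also have "\<dots> = r 2 (s' 2 (r 2 (r 2 (r 1 (r 2 (s' 2 (s' 1 z)))))))"
      by (simp only: rs sq)
    also have "\<dots> = r 2 (s' 2 (r 2 (r 1 (r 2 (r 1 (s' 2 (s' 1 z)))))))"
      by (simp only: rr)
    also have "\<dots> = lam 2 3 (lam 1 3 (lam 1 2 z))"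
      by (simp only: lam_base sr)
    finally show ?thesis .
  qed
  then have "lam k i (lam k j (lam i j (foldr r js z))) = lam i j (lam k j (lam k i (foldr r js z)))" for z
    by (metis 12 13 23)
  then show ?thesis using foldr_r_rev[OF js] by metis
qed

lemma lam_g_comm:
  assumes "distinct [i, j, k]" "{i, j, k} \<subseteq> {1..n}"
  shows "lam i j (g k y) = g k (lam i j y)"
proof -
  have n: "3 \<le> n" using card_mono[OF _ assms(2)] assms(1) by simp
  obtain js where js: "set js \<subseteq> {1..<n}"
    and a: "\<forall>a<3. word_perm (rho_word js) (Suc a) = [i, j, k] ! a"
    using rho_word_tuple[of "[i, j, k]" n] assms by auto
  have p: "word_perm (rho_word js) 1 = i" "word_perm (rho_word js) 2 = j"
    "word_perm (rho_word js) 3 = k"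
    using a[rule_format, of 0] a[rule_format, of 1] a[rule_format, of 2]
    by (simp_all add: numeral_eq_Suc)
  have 12: "foldr r js (lam 1 2 y) = lam i j (foldr r js y)" for y
    using foldr_r_lam[OF js, of 1 2 y] n p by simp
  have 3: "foldr r js (g 3 y) = g k (foldr r js y)" for y
    using foldr_r_g[OF js, of 3 y] n p by simp
  have "lam 1 2 (g 3 z) = g 3 (lam 1 2 z)" for z
    using n by (simp add: lam_base g_s'_far[of 1 3] g_r_far[of 1 3] del: One_nat_def)
  then have "lam i j (g k (foldr r js z)) = g k (lam i j (foldr r js z))" for z
    by (metis 12 3)
  then show ?thesis using foldr_r_rev[OF js] by metis
qed

lemma lam_swap:
  assumes "i \<noteq> j" "{i, j} \<subseteq> {1..n}"
  shows "lam i j y = g i (g j (lam j i (g j (g i y))))"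
proof -
  have n: "2 \<le> n" using card_mono[OF _ assms(2)] assms(1) by simp
  obtain js where js: "set js \<subseteq> {1..<n}"
    and a: "\<forall>a<2. word_perm (rho_word js) (Suc a) = [i, j] ! a"
    using rho_word_tuple[of "[i, j]" n] assms by auto
  have p: "word_perm (rho_word js) 1 = i" "word_perm (rho_word js) 2 = j"
    using a[rule_format, of 0] a[rule_format, of 1] by (simp_all add: numeral_eq_Suc)
  have 12: "foldr r js (lam 1 2 y) = lam i j (foldr r js y)" for y
    using foldr_r_lam[OF js, of 1 2 y] n p by simp
  have 21: "foldr r js (lam 2 1 y) = lam j i (foldr r js y)" for y
    using foldr_r_lam[OF js, of 2 1 y] n p by simp
  have g: "foldr r js (g 1 y) = g i (foldr r js y)" "foldr r js (g 2 y) = g j (foldr r js y)" for y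
    using foldr_r_g[OF js, of 1 y] foldr_r_g[OF js, of 2 y] n p by simp_all
  have "lam 1 2 z = g 1 (g 2 (lam 2 1 (g 2 (g 1 z))))" for z
  proof -
    have sq: "r 1 (r 1 y) = y" for y using n by simp
    have "lam 1 2 z = r 1 (s' 1 (r 1 (r 1 z)))" by (simp only: lam_base sq)
    also have "\<dots> = g 2 (g 1 (s' 1 (g 1 (g 2 (r 1 z)))))"
      using r_s'_r[of 1 "r 1 z"] n by (simp del: One_nat_def)
    also have "\<dots> = g 2 (g 1 (s' 1 (r 1 (g 2 (g 1 z)))))"
      using r_g[of 1] r_g'[of 1] n by (simp del: One_nat_def)
    also have "\<dots> = g 1 (g 2 (lam 2 1 (g 2 (g 1 z))))"
      using g_comm[of 1 2] n by (simp add: lam_base del: One_nat_def)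
    finally show ?thesis .
  qed
  then have "lam i j (foldr r js z) = g i (g j (lam j i (g j (g i (foldr r js z)))))" for z
    by (metis 12 21 g)
  then show ?thesis using foldr_r_rev[OF js] by metis
qed

lemma lam_sub_rel:
  assumes "(u, v) \<in> tvp_rels n"
  shows "foldr act (lam_sub u) y = foldr act (lam_sub v) y"
  using assms
proof (cases rule: tvp_relsE)
  case (LL i j k l)
  then show ?thesis using lam_comm[of i j k l] by (simp add: pw_def)
next
  case (LLL i j k)
  then show ?thesis using lam_braid[of i j k] by (simp add: pw_def)
next
  case (G2 i)
  then show ?thesis by (simp add: pw_def)
next
  case (GG i j)
  then show ?thesis using g_comm[of i j] by (simp add: pw_def)
next
  case (LG i j k)
  then show ?thesis using lam_g_comm[of i j k] by (simp add: pw_def)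
next
  case (GLG i j)
  then show ?thesis using lam_swap[of i j] by (simp add: pw_def)
qed

lemma r_lam_sub_letter:
  assumes "m \<in> {1..<n}" "fst a \<in> tvp_gens n"
  shows "r m (foldr act (lam_sub_letter a) y) =
    foldr act (lam_sub_letter (apfst (relabel (transpose m (Suc m))) a)) (r m y)"
proof (cases a rule: lam_sub_letter.cases)
  case (1 k l b)
  let ?t = "transpose m (Suc m)"
  have kl: "k \<in> {1..n}" "l \<in> {1..n}" "k \<noteq> l" using assms 1 by auto
  have t: "?t permutes {1..n}" using assms by (intro permutes_swap_id) auto
  have tkl: "?t k \<in> {1..n}" "?t l \<in> {1..n}" "?t k \<noteq> ?t l"
    using permutes_in_image[OF t] permutes_inj[OF t] kl by (auto simp: inj_eq simp del: atLeastAtMost_iff)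
  show ?thesis
  proof (cases b)
    case False
    then show ?thesis using 1 r_lam[OF assms(1) kl] by simp
  next
    case True
    let ?z = "foldr act (winv (lam_word k l)) y"
    have "r m y = r m (lam k l ?z)" using kl by (simp add: foldr_act_winv')
    also have "\<dots> = lam (?t k) (?t l) (r m ?z)" by (rule r_lam[OF assms(1) kl])
    finally show ?thesis using 1 True tkl by (simp add: foldr_act_winv)
  qed
next
  case (2 j b)
  then show ?thesis using assms r_g_transpose[of m j]
    by (cases b) (auto simp: g_inverse transpose_def)
qed

lemma r_lam_sub:
  assumes "m \<in> {1..<n}" "w \<in> words (tvp_gens n)"
  shows "r m (foldr act (lam_sub w) y) =
    foldr act (lam_sub (relabel_word (transpose m (Suc m)) w)) (r m y)"
  using assms(2) by (induction w) (simp_all add: r_lam_sub_letter[OF assms(1)])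

lemma act_decompose:
  assumes "fst a \<in> tvb_gens n"
  shows "act a y = foldr act (lam_sub (coc_letter a)) (foldr r (rho_letter a) y)"
proof (cases a rule: coc_letter.cases)
  case (1 i b)
  then have i: "i \<in> {1..<n}" using assms by simp
  have "lam i (Suc i) (s i y) = r i y" "lam (Suc i) i (r i y) = s' i y"
    using i by (simp_all add: lam_less lam_greater chain_def)
  then have "foldr act (winv (lam_word i (Suc i))) (r i y) = s i y" "lam (Suc i) i (r i y) = s' i y"
    using i foldr_act_winv[of "lam_word i (Suc i)" "s i y"] by auto
  then show ?thesis using 1 by simp
next
  case (2 i b)
  then show ?thesis using assms r_inverse by (cases b) auto
next
  case (3 j b)
  then show ?thesis by simp
qed

lemma foldr_act_decompose:
  assumes "w \<in> words (tvb_gens n)"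
  shows "foldr act w y = foldr act (lam_sub (coc w)) (foldr r (rho_part w) y)"
  using assms
proof (induction w)
  case (Cons a w)
  have "foldr r (rho_letter a) (foldr act (lam_sub (coc w)) z) =
      foldr act (lam_sub (relabel_word (letter_perm a) (coc w))) (foldr r (rho_letter a) z)" for z
    using Cons.prems coc_words[of w n] relabel_word_id r_lam_sub[of _ "coc w"]
    by (cases a rule: coc_letter.cases) (simp_all del: map_eq_conv)
  then show ?case using Cons act_decompose[of a] by simp
qed simp

end

lemma tvb_action_pact: "tvb_action n (pact (tvb_gens n) (tvb_rels n))"
  by (simp add: tvb_action_def pres_action_pact)

lemma word_perm_rho_word_fixes:
  "(\<And>j. j \<in> set js \<Longrightarrow> i \<noteq> j \<and> i \<noteq> Suc j) \<Longrightarrow> word_perm (rho_word js) i = i"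
  by (induction js) auto

lemma word_perm_descending: "k \<le> l \<Longrightarrow> word_perm (rho_word (rev [k..<l])) k = l"
  by (induction l rule: dec_induct) auto

lemma word_perm_rho_word_rev: "word_perm (rho_word js) (word_perm (rho_word (rev js)) x) = x"
  by (induction js arbitrary: x) auto

lemma rho_word_trivial:
  assumes "set js \<subseteq> {1..<n}" "word_perm (rho_word js) = id"
  shows "pres_eq (tvb_gens n) (tvb_rels n) (rho_word js) []"
proof -
  interpret tvb_action n "pact (tvb_gens n) (tvb_rels n)" by (rule tvb_action_pact)
  have "pres_eq (tvb_gens n) (tvb_rels n) (rho_word js) []"
    if "m \<le> n" "set js \<subseteq> {1..<m}" "word_perm (rho_word js) = id" for m js
    using that
  proof (induction m arbitrary: js)
    case 0
    then show ?case by (simp add: pres_eq.refl)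
  next
    case (Suc m)
    then obtain us k where us: "set us \<subseteq> {1..<m}" and k: "k \<in> {1..Suc m}"
      and eq: "\<And>y. foldr r js y = foldr r us (foldr r (rev [k..<Suc m]) y)"
      using descending_chain_normal_form[of m js] by (auto simp: atLeastLessThanSuc_atLeastAtMost)
    have "set us \<subseteq> {1..<n}" "set (rev [k..<Suc m]) \<subseteq> {1..<n}" "set js \<subseteq> {1..<n}"
      using us k Suc.prems by auto
    then have js: "pres_eq (tvb_gens n) (tvb_rels n) (rho_word js) (rho_word (us @ rev [k..<Suc m]))"
      using eq by (subst foldr_pact_eq_iff[symmetric])
        (simp_all add: fun_eq_iff foldr_act_rho_word del: upt_Suc set_upt)
    have perm: "word_perm (rho_word us) (word_perm (rho_word (rev [k..<Suc m])) x) = x" for x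
      using fun_cong[OF word_perm_pres_eq[OF js], of x] Suc.prems(3) by (simp del: upt_Suc)
    have "word_perm (rho_word us) (Suc m) = Suc m"
      using us by (intro word_perm_rho_word_fixes) auto
    then have "k = Suc m"
      using perm[of k] k word_perm_descending[of k "Suc m"] by (simp del: upt_Suc)
    then have "pres_eq (tvb_gens n) (tvb_rels n) (rho_word js) (rho_word us)" using js by simp
    moreover have "word_perm (rho_word us) = id"
      using perm \<open>k = Suc m\<close> by (simp add: fun_eq_iff)
    ultimately show ?case using Suc.IH[of us] us Suc.prems by (blast intro: pres_eq.trans Suc_leD)
  qed
  then show ?thesis using assms by blast
qed

section \<open>The isomorphism\<close>

lemma coc_rho_word [simp]: "coc (rho_word js) = []"
  by (induction js) auto

lemma rev_rho_word: "rev (rho_word js) = rho_word (rev js)"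
  by (simp add: rho_word_def pw_def rev_map)

lemma rho_chain_rho_word: "rho_chain i j = rho_word (rev [Suc i..<j])"
  by (simp add: rho_chain_def rho_word_def)

lemma word_perm_lam_word: "word_perm (lam_word k l) = id"
proof -
  have "word_perm (rho_chain i j) (word_perm (rev (rho_chain i j)) x) = x" for i j x
    using word_perm_rho_word_rev[of "rev [Suc i..<j]"] by (simp add: rho_chain_rho_word rev_rho_word)
  then show ?thesis by (auto simp: lam_word_def fun_eq_iff)
qed

lemma coc_lam_word:
  assumes "k \<noteq> l"
  shows "coc (lam_word k l) = [(L k l, False)]"
proof -
  have "word_perm (rho_chain i j) i = i" "word_perm (rho_chain i j) (Suc i) = j" if "i < j" for i j
    using that word_perm_descending[of "Suc i" j]
    by (auto simp: rho_chain_rho_word intro: word_perm_rho_word_fixes)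
  moreover have "coc (rho_chain i j) = []" "coc (rev (rho_chain i j)) = []" for i j
    by (simp_all add: rho_chain_rho_word rev_rho_word)
  ultimately show ?thesis using assms by (auto simp: lam_word_def coc_append)
qed

lemma lam_sub_pres_eq:
  assumes "pres_eq (tvp_gens n) (tvp_rels n) u v"
  shows "pres_eq (tvb_gens n) (tvb_rels n) (lam_sub u) (lam_sub v)"
  using assms
proof (rule pres_eq_substitution)
  interpret tvb_action n "pact (tvb_gens n) (tvb_rels n)" by (rule tvb_action_pact)
  show "pres_eq (tvb_gens n) (tvb_rels n) (lam_sub [(x, b), (x, \<not> b)]) []" if "x \<in> tvp_gens n" for x b
  proof (subst foldr_pact_eq_iff[symmetric])
    show "foldr (pact (tvb_gens n) (tvb_rels n)) (lam_sub [(x, b), (x, \<not> b)]) =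
        foldr (pact (tvb_gens n) (tvb_rels n)) []"
      using that by (cases x; cases b) (auto simp: fun_eq_iff foldr_act_winv foldr_act_winv')
  qed (use that in \<open>auto simp: lam_sub_letter_words\<close>)
  show "pres_eq (tvb_gens n) (tvb_rels n) (lam_sub l) (lam_sub r)"
    if "(l, r) \<in> tvp_rels n" "l \<in> words (tvp_gens n)" "r \<in> words (tvp_gens n)" for l r
    using that lam_sub_rel[OF that(1)] by (subst foldr_pact_eq_iff[symmetric]) (auto simp: lam_sub_words)
qed (auto simp: lam_sub_words)

lemma lam_word_winv:
  assumes "k \<in> {1..n}" "l \<in> {1..n}" "k \<noteq> l"
  shows "pres_eq (tvb_gens n) (tvb_rels n) (lam_word k l @ winv (lam_word k l)) []"
  using lam_sub_pres_eq[OF pres_eq.cancel[of "[]" _ "[]" "L k l" "tvp_rels n" False]] assms by simp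

lemma word_perm_lam_sub:
  assumes "w \<in> words (tvp_gens n)"
  shows "word_perm (lam_sub w) = id"
  using assms
proof (induction w)
  case (Cons a w)
  have "word_perm (lam_sub_letter a) = id"
  proof (cases a rule: lam_sub_letter.cases)
    case (1 k l b)
    then have "word_perm (lam_word k l @ winv (lam_word k l)) = id"
      using Cons.prems word_perm_pres_eq[OF lam_word_winv[of k n l]] by simp
    then show ?thesis using 1 by (simp add: word_perm_lam_word)
  qed simp
  with Cons show ?case by simp
qed simp

lemma coc_lam_sub:
  assumes "w \<in> words (tvp_gens n)"
  shows "pres_eq (tvp_gens n) (tvp_rels n) (coc (lam_sub w)) w"
  using assms
proof (induction w)
  case Nil
  then show ?case by (simp add: pres_eq.refl)
next
  case (Cons a w)
  let ?eq = "pres_eq (tvp_gens n) (tvp_rels n)"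
  have a: "[a] \<in> words (tvp_gens n)" using Cons.prems by simp
  have "?eq (coc (lam_sub_letter a)) [a]"
  proof (cases a rule: lam_sub_letter.cases)
    case (1 k l b)
    then have kl: "k \<in> {1..n}" "l \<in> {1..n}" "k \<noteq> l" using Cons.prems by auto
    show ?thesis
    proof (cases b)
      case False
      then show ?thesis using 1 kl coc_lam_word[of k l] pres_eq.refl[OF a] by simp
    next
      case True
      let ?c = "coc (winv (lam_word k l))"
      have c: "?c \<in> words (tvp_gens n)" using kl by (intro coc_words) simp
      have "coc (lam_word k l @ winv (lam_word k l)) = (L k l, False) # ?c"
        using coc_lam_word[OF kl(3)] unfolding coc_append word_perm_lam_word relabel_word_id by simp
      then have "?eq ((L k l, False) # ?c) []"
        using coc_pres_eq[OF lam_word_winv[OF kl]] by simp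
      then have "?eq ([(L k l, True)] @ ((L k l, False) # ?c) @ []) ([(L k l, True)] @ [] @ [])"
        using kl by (intro pres_eq_context) auto
      moreover have "?eq ([(L k l, True)] @ ((L k l, False) # ?c) @ []) ?c"
        using pres_eq.cancel[of "[]" _ ?c "L k l" "tvp_rels n" True] kl c by simp
      ultimately have "?eq ?c [(L k l, True)]"
        by (metis append_Nil2 pres_eq.sym pres_eq.trans)
      then show ?thesis using 1 True by simp
    qed
  next
    case (2 j b)
    then show ?thesis using pres_eq.refl[OF a] by simp
  qed
  moreover have "word_perm (lam_sub_letter a) = id"
    using word_perm_lam_sub[OF a] by simp
  ultimately show ?case
    using Cons pres_eq_append[of "tvp_gens n" "tvp_rels n" "coc (lam_sub_letter a)" "[a]" "coc (lam_sub w)" w]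
    by (simp only: lam_sub_simps coc_append relabel_word_id words_simps append_Cons append_Nil)
qed

lemma lam_sub_coc:
  assumes "w \<in> words (tvb_gens n)" "word_perm w = id"
  shows "pres_eq (tvb_gens n) (tvb_rels n) (lam_sub (coc w)) w"
proof -
  interpret tvb_action n "pact (tvb_gens n) (tvb_rels n)" by (rule tvb_action_pact)
  let ?eq = "pres_eq (tvb_gens n) (tvb_rels n)"
  have H: "lam_sub (coc w) \<in> words (tvb_gens n)" using assms by (intro lam_sub_words coc_words)
  have "foldr (pact (tvb_gens n) (tvb_rels n)) w =
      foldr (pact (tvb_gens n) (tvb_rels n)) (lam_sub (coc w) @ rho_word (rho_part w))"
    using foldr_act_decompose[OF assms(1)] by (simp add: fun_eq_iff foldr_act_rho_word)
  then have "?eq w (lam_sub (coc w) @ rho_word (rho_part w))"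
    using assms H rho_part_set[OF assms(1)] by (subst foldr_pact_eq_iff[symmetric]) auto
  moreover have "?eq (rho_word (rho_part w)) []"
    using assms rho_part_set by (intro rho_word_trivial) (auto simp: word_perm_rho_part)
  ultimately show ?thesis
    using pres_eq_append[OF pres_eq.refl[OF H]] by (metis append_Nil2 pres_eq.sym pres_eq.trans)
qed

lemma phiP_tvb_class:
  assumes "w \<in> words (tvb_gens n)"
  shows "phiP (tvb_class n w) = word_perm w"
  using word_perm_pres_eq[OF pres_eq_SOME[OF assms]] by (simp add: phiP_def tvb_class_def)

lemma TVP_eq: "TVP n = tvb_class n ` {w \<in> words (tvb_gens n). word_perm w = id}"
  by (auto simp: TVP_def TVB_def carrier_pres_group tvb_class_def[symmetric] phiP_tvb_class
      image_iff cong: conj_cong)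

theorem mainTheorem2:
  fixes n :: nat
  assumes "n \<ge> 2"
  shows "\<exists>h. h \<in> iso (TVP_pres n) ((TVB n)\<lparr>carrier := TVP n\<rparr>)
           \<and> (\<forall>k l. 1 \<le> k \<and> k \<le> n \<and> 1 \<le> l \<and> l \<le> n \<and> k \<noteq> l \<longrightarrow>
                 h (tvp_class n (pw [L k l])) = tvb_class n (lam_word k l))
           \<and> (\<forall>j. 1 \<le> j \<and> j \<le> n \<longrightarrow>
                 h (tvp_class n (pw [G j])) = tvb_class n (pw [Gm j]))"
proof -
  define h where "h A = tvb_class n (lam_sub (SOME w. w \<in> A))" for A
  have h: "h (tvp_class n w) = tvb_class n (lam_sub w)" if "w \<in> words (tvp_gens n)" for w
    using pres_eq.sym[OF lam_sub_pres_eq[OF pres_eq_SOME[OF that]]]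
    unfolding h_def tvp_class_def tvb_class_def by (subst pres_class_eq_iff) (auto dest: pres_eq_words)
  have carrier: "carrier (TVP_pres n) = tvp_class n ` words (tvp_gens n)"
    by (auto simp: TVP_pres_def carrier_pres_group tvp_class_def)
  have mem: "tvb_class n (lam_sub w) \<in> TVP n" if "w \<in> words (tvp_gens n)" for w
    unfolding TVP_eq using that by (intro imageI) (simp add: lam_sub_words word_perm_lam_sub)
  have hom: "h \<in> hom (TVP_pres n) ((TVB n)\<lparr>carrier := TVP n\<rparr>)"
  proof (rule homI)
    fix A assume "A \<in> carrier (TVP_pres n)"
    then show "h A \<in> carrier ((TVB n)\<lparr>carrier := TVP n\<rparr>)" using mem by (auto simp: carrier h)
  next
    fix A B assume "A \<in> carrier (TVP_pres n)" "B \<in> carrier (TVP_pres n)"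
    then obtain u v where uv: "u \<in> words (tvp_gens n)" "v \<in> words (tvp_gens n)"
      "A = tvp_class n u" "B = tvp_class n v" by (auto simp: carrier)
    then have "A \<otimes>\<^bsub>TVP_pres n\<^esub> B = tvp_class n (u @ v)"
      by (simp add: TVP_pres_def tvp_class_def mult_pres_class)
    then have "h (A \<otimes>\<^bsub>TVP_pres n\<^esub> B) = tvb_class n (lam_sub u @ lam_sub v)"
      using uv by (simp add: h)
    also have "\<dots> = h A \<otimes>\<^bsub>TVB n\<^esub> h B"
      using uv by (simp add: h TVB_def tvb_class_def mult_pres_class lam_sub_words)
    finally show "h (A \<otimes>\<^bsub>TVP_pres n\<^esub> B) = h A \<otimes>\<^bsub>(TVB n)\<lparr>carrier := TVP n\<rparr>\<^esub> h B" by simp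
  qed
  have inj: "inj_on h (carrier (TVP_pres n))"
  proof (rule inj_onI)
    fix A B assume "A \<in> carrier (TVP_pres n)" "B \<in> carrier (TVP_pres n)" and eq: "h A = h B"
    then obtain u v where uv: "u \<in> words (tvp_gens n)" "v \<in> words (tvp_gens n)"
      "A = tvp_class n u" "B = tvp_class n v" by (auto simp: carrier)
    then have "pres_eq (tvb_gens n) (tvb_rels n) (lam_sub u) (lam_sub v)"
      using eq by (simp add: h tvb_class_def pres_class_eq_iff lam_sub_words)
    then have "pres_eq (tvp_gens n) (tvp_rels n) (coc (lam_sub u)) (coc (lam_sub v))"
      by (rule coc_pres_eq)
    then have "pres_eq (tvp_gens n) (tvp_rels n) u v"
      using coc_lam_sub[OF uv(1)] coc_lam_sub[OF uv(2)] by (blast intro: pres_eq.sym pres_eq.trans)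
    then show "A = B" using uv by (simp add: tvp_class_def pres_class_eq_iff)
  qed
  have surj: "h ` carrier (TVP_pres n) = TVP n"
  proof
    show "h ` carrier (TVP_pres n) \<subseteq> TVP n" using mem by (auto simp: carrier h)
    show "TVP n \<subseteq> h ` carrier (TVP_pres n)"
    proof
      fix A assume "A \<in> TVP n"
      then obtain w where w: "w \<in> words (tvb_gens n)" "word_perm w = id" "A = tvb_class n w"
        by (auto simp: TVP_eq)
      have "h (tvp_class n (coc w)) = A"
        using lam_sub_coc[OF w(1,2)] w coc_words[OF w(1)]
        by (simp add: h tvb_class_def pres_class_eq_iff lam_sub_words)
      then show "A \<in> h ` carrier (TVP_pres n)" using coc_words[OF w(1)] by (auto simp: carrier)
    qed
  qed
  have "h \<in> iso (TVP_pres n) ((TVB n)\<lparr>carrier := TVP n\<rparr>)"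
    using hom inj surj by (simp add: iso_def bij_betw_def)
  then show ?thesis
    by (intro exI[of _ h] conjI allI impI) (simp_all add: h pw_def)
qed

end
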